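(* Let $m<d$ be positive integers, let $Y$ be an $\mathbb{R}^d$-valued random variable and $\phi:\mathbb{R}^d\to\mathbb{R}$ a measurable function with $\mathrm{E}[\phi^2(Y)]<+\infty$. Let $g_1,\dots,g_m$ be probability densities with respect to the Lebesgue measure on $\mathbb{R}$, $g(x_1,\dots,x_m)=\prod_{k=1}^m g_k(x_k)$, and let $\mu$ be a $d\times m$ orthonormal matrix such that $\mu^TY$ has a density $f_\mu$ with respect to the Lebesgue measure $\lambda$ on $\mathbb{R}^m$. Put $\psi_\mu(x)=\mathrm{E}[\phi(Y)\mid \mu^TY=x]$ and $\zeta_\mu(x)=\mathrm{E}[\phi^2(Y)\mid\mu^TY=x]$. Assume that $\int_{\mathbb{R}^m} f_\mu\sqrt{\zeta_\mu-\psi_\mu^2}\,d\lambda>0$ and that, for every $h\in\{f_\mu,\ \zeta_\mu f_\mu,\ \psi_\mu f_\mu\}$, $\int_{\mathbb{R}^m}h^2/g\,d\lambda<+\infty$. Define the probability density $$\chi_\mu^\star=\frac{f_\mu\sqrt{\zeta_\mu-\psi_\mu^2}}{\int_{\mathbb{R}^m}f_\mu\sqrt{\zeta_\mu-\psi_\mu^2}\,d\lambda}.$$ With the strata $\mathsf{S}_{\mathbf{i}}$, the optimal allocation $\mathcal{Q}^\star(\mu)=\{q^\star_{\mathbf{i}}(\mu),\ \mathbf{i}\in\{1,\dots,I\}^m\}$, the quantity $\varsigma^2_{I,M}$ and the quantity $\varsigma_\infty^2$ defined in the context, $$\lim_{I\to+\infty}\ \sum_{\mathbf{i}\in\{1,\dots,I\}^m}\Big|q^\star_{\mathbf{i}}(\mu)-\int_{\mathsf{S}_{\mathbf{i}}}\chi_\mu^\star\,d\lambda\Big|=0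 .$$ Moreover, if $\{I_M,M\ge1\}$ is a sequence of positive integers such that $I_M^{-1}+I_M^mM^{-1}\to0$ as $M\to+\infty$, then $$\lim_{M\to+\infty}M\,\varsigma^2_{I_M,M}(\mu,g,\mathcal{Q}^\star(\mu))=\varsigma_\infty^2(\mu,\chi_\mu^\star).$$
   Context: Conventions: $z/0=+\infty$ if $z>0$ and $z/0=0$ if $z=0$. A $d\times m$ matrix $\mu$ is orthonormal if $\mu^T\mu$ is the $m\times m$ identity. For a probability density $h$ on $\mathbb{R}$ with cumulative distribution function $H$, the quantile function is $H^{-1}(u)=\inf\{x\in\{H>0\}:H(x)\ge u\}$, $u\in[0,1]$, with $\inf\emptyset=+\infty$. Let $G_k$ be the c.d.f. of $g_k$. For a positive integer $I$ and $\mathbf{i}=(i_1,\dots,i_m)\in\{1,\dots,I\}^m$, the stratum is $$\mathsf{S}_{\mathbf{i}}=\prod_{k=1}^m\Big(G_k^{-1}\big(\tfrac{i_k-1}{I}\big),G_k^{-1}\big(\tfrac{i_k}{I}\big)\Big]\subset\mathbb{R}^m .$$ Put $p_{\mathbf{i}}(\mu)=\mathrm{P}(\mu^TY\in\mathsf{S}_{\mathbf{i}})$ and let $\sigma^2_{\mathbf{i}}(\mu)$ be the conditional variance of $\phi(Y)$ given $\mu^TY\in\mathsf{S}_{\mathbf{i}}$ (with $p_{\mathbf{i}}(\mu)\sigma_{\mathbf{i}}(\mu)=0$ if $p_{\mathbf{i}}(\mu)=0$), so that $p_{\mathbf{i}}^2(\mu)\sigma_{\mathbf{i}}^2(\mu)=\big(\int_{\mathsf{S}_{\mathbf{i}}}f_\mu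 d\lambda\big)\big(\int_{\mathsf{S}_{\mathbf{i}}}\zeta_\mu f_\mu d\lambda\big)-\big(\int_{\mathsf{S}_{\mathbf{i}}}\psi_\mu f_\mu d\lambda\big)^2$. Fix a total order on the index set $\{1,\dots,I\}^m$. For an allocation $\mathcal{Q}=\{q_{\mathbf{i}}\}$ ($q_{\mathbf{i}}\ge0$, $\sum_{\mathbf i} q_{\mathbf{i}}=1$) and a positive integer $M$ (total number of draws), let $$M_{\mathbf{i}}=\Big\lfloor M\sum_{\mathbf{j}\le\mathbf{i}}q_{\mathbf{j}}\Big\rfloor-\Big\lfloor M\sum_{\mathbf{j}<\mathbf{i}}q_{\mathbf{j}}\Big\rfloor$$ (empty sums are $0$) and $$\varsigma^2_{I,M}(\mu,g,\mathcal{Q})=\sum_{\mathbf{i}\in\{1,\dots,I\}^m:\,M_{\mathbf{i}}>0}M_{\mathbf{i}}^{-1}\,p^2_{\mathbf{i}}(\mu)\,\sigma^2_{\mathbf{i}}(\mu).$$ The optimal allocation is $$q^\star_{\mathbf{i}}(\mu)=\frac{p_{\mathbf{i}}(\mu)\sigma_{\mathbf{i}}(\mu)}{\sum_{\mathbf{j}\in\{1,\dots,I\}^m}p_{\mathbf{j}}(\mu)\sigma_{\mathbf{j}}(\mu)} .$$ For a probability density $\chi$ on $\mathbb{R}^m$, $\varsigma_\infty^2(\mu,\chi)=\int_{\mathbb{R}^m}f_\mu^2(\zeta_\mu-\psi_\mu^2)/\chi\,d\lambda$. *)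

theory Defs
  imports "HOL-Probability.Probability"
begin

definition prob_density :: "(real \<Rightarrow> real) \<Rightarrow> bool" where
  "prob_density h \<longleftrightarrow> h \<in> borel_measurable borel \<and> (\<forall>x. 0 \<le> h x) \<and>
     (\<integral>\<^sup>+ x. ennreal (h x) \<partial>lborel) = 1"

text \<open>
  The quantile function is valued in the extended reals: the infimum of the empty set
  is \<open>\<infinity>\<close>, and the value at \<open>0\<close> is \<open>-\<infinity>\<close> if the support is unbounded below.
\<close>
definition quantile :: "(real \<Rightarrow> real) \<Rightarrow> real \<Rightarrow> ereal" where
  "quantile h u =
     (INF x \<in> {x. cdf (density lborel (\<lambda>t. ennreal (h t))) x > 0 \<and>
                  cdf (density lborel (\<lambda>t. ennreal (h t))) x \<ge> u}. ereal x)"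

definition strata_index :: "nat \<Rightarrow> ('m::finite \<Rightarrow> nat) set" where
  "strata_index I = (UNIV \<rightarrow>\<^sub>E {1..I})"

definition stratum ::
  "('m::finite \<Rightarrow> real \<Rightarrow> real) \<Rightarrow> nat \<Rightarrow> ('m \<Rightarrow> nat) \<Rightarrow> (real ^ 'm) set" where
  "stratum g I i = {x. \<forall>k. quantile (g k) ((real (i k) - 1) / real I) < ereal (x $ k) \<and>
                           ereal (x $ k) \<le> quantile (g k) (real (i k) / real I)}"

text \<open>
  \<open>h\<close> is a version of \<open>x \<mapsto> E[Z | X = x]\<close>: a Borel function such that \<open>h \<circ> X\<close> is a version of
  the conditional expectation of \<open>Z\<close> given the sigma-algebra generated by \<open>X\<close>.
\<close>
definition cond_exp_given ::
  "'a measure \<Rightarrow> ('a \<Rightarrow> real) \<Rightarrow> ('a \<Rightarrow> 'b::topological_space) \<Rightarrow> ('b \<Rightarrow> real) \<Rightarrow> bool" where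
  "cond_exp_given P Z X h \<longleftrightarrow> h \<in> borel_measurable borel \<and>
     (AE \<omega> in P. real_cond_exp P (vimage_algebra (space P) X borel) Z \<omega> = h (X \<omega>))"

definition stratum_event ::
  "'a measure \<Rightarrow> ('a \<Rightarrow> real ^ 'd) \<Rightarrow> real ^ 'm ^ 'd \<Rightarrow> ('m::finite \<Rightarrow> real \<Rightarrow> real) \<Rightarrow>
   nat \<Rightarrow> ('m \<Rightarrow> nat) \<Rightarrow> 'a set" where
  "stratum_event P Y \<mu> g I i = {\<omega> \<in> space P. transpose \<mu> *v Y \<omega> \<in> stratum g I i}"

definition stratum_prob ::
  "'a measure \<Rightarrow> ('a \<Rightarrow> real ^ 'd) \<Rightarrow> real ^ 'm ^ 'd \<Rightarrow> ('m::finite \<Rightarrow> real \<Rightarrow> real) \<Rightarrow>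
   nat \<Rightarrow> ('m \<Rightarrow> nat) \<Rightarrow> real" where
  "stratum_prob P Y \<mu> g I i = measure P (stratum_event P Y \<mu> g I i)"

text \<open>
  The conditional variance of \<open>\<phi>(Y)\<close> is its variance under the conditional probability given the
  stratum. On a stratum of probability zero \<open>uniform_measure\<close> has density zero almost
  everywhere, so the value is then \<open>0\<close>.
\<close>
definition stratum_var ::
  "'a measure \<Rightarrow> ('a \<Rightarrow> real ^ 'd) \<Rightarrow> (real ^ 'd \<Rightarrow> real) \<Rightarrow> real ^ 'm ^ 'd \<Rightarrow>
   ('m::finite \<Rightarrow> real \<Rightarrow> real) \<Rightarrow> nat \<Rightarrow> ('m \<Rightarrow> nat) \<Rightarrow> real" where
  "stratum_var P Y \<phi> \<mu> g I i =
     prob_space.variance (uniform_measure P (stratum_event P Y \<mu> g I i)) (\<lambda>\<omega>. \<phi> (Y \<omega>))"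

definition stratum_sd ::
  "'a measure \<Rightarrow> ('a \<Rightarrow> real ^ 'd) \<Rightarrow> (real ^ 'd \<Rightarrow> real) \<Rightarrow> real ^ 'm ^ 'd \<Rightarrow>
   ('m::finite \<Rightarrow> real \<Rightarrow> real) \<Rightarrow> nat \<Rightarrow> ('m \<Rightarrow> nat) \<Rightarrow> real" where
  "stratum_sd P Y \<phi> \<mu> g I i = sqrt (stratum_var P Y \<phi> \<mu> g I i)"

definition opt_alloc ::
  "'a measure \<Rightarrow> ('a \<Rightarrow> real ^ 'd) \<Rightarrow> (real ^ 'd \<Rightarrow> real) \<Rightarrow> real ^ 'm ^ 'd \<Rightarrow>
   ('m::finite \<Rightarrow> real \<Rightarrow> real) \<Rightarrow> nat \<Rightarrow> ('m \<Rightarrow> nat) \<Rightarrow> real" where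
  "opt_alloc P Y \<phi> \<mu> g I i =
     stratum_prob P Y \<mu> g I i * stratum_sd P Y \<phi> \<mu> g I i /
     (\<Sum>j \<in> strata_index I. stratum_prob P Y \<mu> g I j * stratum_sd P Y \<phi> \<mu> g I j)"

text \<open>The relation \<open>r\<close> is the (reflexive) total order on the indices.\<close>
definition num_draws ::
  "(('m::finite \<Rightarrow> nat) \<times> ('m \<Rightarrow> nat)) set \<Rightarrow> nat \<Rightarrow> nat \<Rightarrow> (('m \<Rightarrow> nat) \<Rightarrow> real) \<Rightarrow>
   ('m \<Rightarrow> nat) \<Rightarrow> int" where
  "num_draws r I M q i =
     \<lfloor>real M * (\<Sum>j \<in> {j \<in> strata_index I. (j, i) \<in> r}. q j)\<rfloor> -
     \<lfloor>real M * (\<Sum>j \<in> {j \<in> strata_index I. (j, i) \<in> r \<and> j \<noteq> i}. q j)\<rfloor>"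

definition strat_variance ::
  "'a measure \<Rightarrow> ('a \<Rightarrow> real ^ 'd) \<Rightarrow> (real ^ 'd \<Rightarrow> real) \<Rightarrow>
   (('m::finite \<Rightarrow> nat) \<times> ('m \<Rightarrow> nat)) set \<Rightarrow> nat \<Rightarrow> nat \<Rightarrow>
   real ^ 'm ^ 'd \<Rightarrow> ('m \<Rightarrow> real \<Rightarrow> real) \<Rightarrow> (('m \<Rightarrow> nat) \<Rightarrow> real) \<Rightarrow> real" where
  "strat_variance P Y \<phi> r I M \<mu> g q =
     (\<Sum>i \<in> {i \<in> strata_index I. num_draws r I M q i > 0}.
        inverse (real_of_int (num_draws r I M q i)) *
        (stratum_prob P Y \<mu> g I i)\<^sup>2 * stratum_var P Y \<phi> \<mu> g I i)"

definition opt_density ::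
  "(real ^ 'm::finite \<Rightarrow> real) \<Rightarrow> (real ^ 'm \<Rightarrow> real) \<Rightarrow> (real ^ 'm \<Rightarrow> real) \<Rightarrow> real ^ 'm \<Rightarrow> real" where
  "opt_density f \<zeta> \<psi> x =
     f x * sqrt (\<zeta> x - (\<psi> x)\<^sup>2) / (\<integral>y. f y * sqrt (\<zeta> y - (\<psi> y)\<^sup>2) \<partial>lborel)"

text \<open>
  Division in \<^typ>\<open>ennreal\<close> follows the convention \<open>z / 0 = \<infinity>\<close> for \<open>z > 0\<close> and \<open>0 / 0 = 0\<close>.
  Negative values of \<open>\<zeta> - \<psi>\<^sup>2\<close> occur only where \<open>f\<close> vanishes, up to a null set.
\<close>
definition asymp_variance ::
  "(real ^ 'm::finite \<Rightarrow> real) \<Rightarrow> (real ^ 'm \<Rightarrow> real) \<Rightarrow> (real ^ 'm \<Rightarrow> real) \<Rightarrow>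
   (real ^ 'm \<Rightarrow> real) \<Rightarrow> ennreal" where
  "asymp_variance f \<zeta> \<psi> \<rho> =
     (\<integral>\<^sup>+ x. ennreal ((f x)\<^sup>2 * (\<zeta> x - (\<psi> x)\<^sup>2)) / ennreal (\<rho> x) \<partial>lborel)"

end

theory Submission
  imports Defs
begin

text \<open>
  Let \<open>N\<close> be the product measure with density \<open>g\<close>; every stratum has \<open>N\<close>-measure \<open>I\<close> to the power \<open>-m\<close>.
  Finiteness of the integral of \<open>f\<^sup>2 / g\<close> forces \<open>f = 0\<close> where \<open>g = 0\<close>, so \<open>F = f / g\<close>, \<open>Z = \<zeta> f / g\<close> and
  \<open>Q = \<psi> f / g\<close> are \<open>N\<close>-integrable and represent the integrals over the strata. Averaging over the
  strata converges in \<open>L\<^sup>1(N)\<close>: for the indicator of an orthant \<open>{..a}\<close> only the strata with one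
  side containing a coordinate of \<open>a\<close> contribute, and their total mass is at most \<open>m / I\<close>; the
  general case follows by Dynkin's theorem and approximation. On a stratum \<open>p \<sigma>\<close> is the square
  root of the discriminant \<open>F Z - Q\<^sup>2\<close> formed with the stratum integrals, and since
  \<open>\<bar>sqrt a - sqrt b\<bar> \<le> 2 * sqrt \<bar>a - b\<bar>\<close>, a weighted arithmetic-geometric mean
  inequality turns \<open>L\<^sup>1\<close> convergence of the averages into \<open>L\<^sup>1\<close> convergence of these square roots.
  For the variance only \<open>\<bar>M\<^sub>i - M q\<^sub>i\<bar> < 1\<close> matters: it bounds the relative error by twice the
  number of strata divided by \<open>M\<close>.
\<close>

subsection \<open>Rounded allocations\<close>

text \<open>The upper bound combines \<open>M * x < n + 1\<close> with
  \<open>n + 1 \<le> 2 * n\<close>, valid because the integer \<open>n\<close> is at least 1. The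
  lower bound combines \<open>n < M * x + 1\<close> with
  \<open>(M * x - 1) * (M * x + 1) \<le> (M * x)^2\<close>. In the application \<open>x\<close> is
  the share of a stratum and \<open>n\<close> its rounded number of draws.\<close>

lemma floor_allocation_ratio_bounds:
  fixes x M :: real and n :: int
  assumes "0 < n" "0 \<le> x" "0 < M" "\<bar>real_of_int n - M * x\<bar> < 1"
  shows "M * x\<^sup>2 / n \<le> x + 2 / M" and "x - 1 / M \<le> M * x\<^sup>2 / n"
proof -
  have n: "real_of_int n \<ge> 1"
    using assms by linarith
  have "M * (M * x\<^sup>2) = (M * x) * (M * x)"
    by (simp add: power2_eq_square)
  also have "\<dots> \<le> M * x * (n + 1)"
    using assms by (intro mult_left_mono) auto
  also have "M * x \<le> 2 * n"
    using assms n by linarith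
  then have "M * x * (n + 1) \<le> (M * x + 2) * n"
    by (simp add: algebra_simps)
  finally show "M * x\<^sup>2 / n \<le> x + 2 / M"
    using assms n by (simp add: field_simps)
  \<comment> \<open>Multiplying \<open>n < M * x + 1\<close> by \<open>M * x - 1\<close> keeps the
    order only if this factor is nonnegative; otherwise the left side is already
    nonpositive.\<close>
  have "(M * x - 1) * n \<le> (M * x)\<^sup>2"
  proof (cases "M * x \<le> 1")
    case True
    then have "(M * x - 1) * n \<le> 0"
      using n by (simp add: mult_nonpos_nonneg)
    then show ?thesis
      by (meson order_trans zero_le_power2)
  next
    case False
    then have "(M * x - 1) * n \<le> (M * x - 1) * (M * x + 1)"
      using assms by (intro mult_left_mono) linarith+
    also have "\<dots> \<le> (M * x)\<^sup>2"
      by (simp add: algebra_simps power2_eq_square)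
    finally show ?thesis .
  qed
  then show "x - 1 / M \<le> M * x\<^sup>2 / n"
    using assms n by (simp add: field_simps power2_eq_square)
qed

text \<open>A stratum with draws contributes its share up to an error \<open>2 / M\<close>, and a
  stratum without draws has share at most \<open>1 / M\<close>, so omitting it costs at most that.
  The shares add up to 1, which leaves only these errors.\<close>

lemma rounded_allocation_variance:
  fixes q :: "'i \<Rightarrow> real" and n :: "'i \<Rightarrow> int"
  assumes "finite J" "0 < M" "\<And>i. i \<in> J \<Longrightarrow> 0 \<le> q i" "(\<Sum>i\<in>J. q i) = 1"
    and n: "\<And>i. i \<in> J \<Longrightarrow> \<bar>real_of_int (n i) - M * q i\<bar> < 1"
  shows "\<bar>(\<Sum>i\<in>{i \<in> J. 0 < n i}. M * (q i)\<^sup>2 / n i) - 1\<bar> \<le> 2 * card J / M"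
proof -
  let ?J = "{i \<in> J. 0 < n i}"
  have split: "(\<Sum>i\<in>?J. q i) + (\<Sum>i\<in>J - ?J. q i) = 1"
    using assms sum.subset_diff[of ?J J q] by auto
  have zero: "q i \<le> 1 / M" if "i \<in> J - ?J" for i
  proof -
    have "M * q i < 1"
      using n[of i] that by auto
    then show ?thesis
      using \<open>0 < M\<close> by (simp add: field_simps)
  qed
  have "(\<Sum>i\<in>J - ?J. q i) \<le> card (J - ?J) * (1 / M)"
    using zero by (rule sum_bounded_above)
  then have small: "(\<Sum>i\<in>J - ?J. q i) \<le> card J / M"
    using assms card_mono[of J "J - ?J"] by (auto simp: field_simps)
  have cardJ: "card ?J / M \<le> card J / M"
    using assms card_mono[of J ?J] by (auto intro!: divide_right_mono)
  have "(\<Sum>i\<in>?J. M * (q i)\<^sup>2 / n i) \<le> (\<Sum>i\<in>?J. q i + 2 / M)"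
    using assms by (intro sum_mono floor_allocation_ratio_bounds) auto
  also have "\<dots> = (\<Sum>i\<in>?J. q i) + 2 * card ?J / M"
    by (simp add: sum.distrib)
  also have "\<dots> \<le> 1 + 2 * card J / M"
    using split sum_nonneg[of "J - ?J" q] assms cardJ by auto
  finally have upper: "(\<Sum>i\<in>?J. M * (q i)\<^sup>2 / n i) \<le> 1 + 2 * card J / M" .
  have "1 - 2 * card J / M \<le> (\<Sum>i\<in>?J. q i) - card ?J / M"
    using split small cardJ by auto
  also have "\<dots> = (\<Sum>i\<in>?J. q i - 1 / M)"
    by (simp add: sum_subtractf)
  also have "\<dots> \<le> (\<Sum>i\<in>?J. M * (q i)\<^sup>2 / n i)"
    using assms by (intro sum_mono floor_allocation_ratio_bounds) auto
  finally show ?thesis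
    using upper by auto
qed

subsection \<open>Square roots of discriminants over fine partitions\<close>

text \<open>\<open>sqrt\<close> on the reals is odd, so arguments of equal sign reduce to
  subadditivity of the root. For opposite signs each root is bounded separately, whence the factor
  2. The bound is later applied to discriminants whose sign is not controlled pointwise.\<close>

lemma abs_sqrt_diff_le:
  fixes a b :: real
  shows "\<bar>sqrt a - sqrt b\<bar> \<le> 2 * sqrt \<bar>a - b\<bar>"
proof -
  have *: "sqrt x - sqrt y \<le> sqrt (x - y)" if "0 \<le> y" "y \<le> x" for x y :: real
    using sqrt_add_le_add_sqrt[of y "x - y"] that by simp
  have same: "\<bar>sqrt x - sqrt y\<bar> \<le> 2 * sqrt \<bar>x - y\<bar>" if "0 \<le> x" "0 \<le> y" for x y :: real
  proof (cases "x \<le> y")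
    case True
    then have "sqrt y - sqrt x \<le> sqrt (y - x)" "sqrt x \<le> sqrt y" "0 \<le> sqrt (y - x)"
      using *[of x y] that by auto
    moreover have eq: "\<bar>sqrt x - sqrt y\<bar> = sqrt y - sqrt x" "\<bar>x - y\<bar> = y - x"
      using True by auto
    ultimately show ?thesis
      unfolding eq by linarith
  next
    case False
    then have "sqrt x - sqrt y \<le> sqrt (x - y)" "sqrt y \<le> sqrt x" "0 \<le> sqrt (x - y)"
      using *[of y x] that by auto
    moreover have eq: "\<bar>sqrt x - sqrt y\<bar> = sqrt x - sqrt y" "\<bar>x - y\<bar> = x - y"
      using False by auto
    ultimately show ?thesis
      unfolding eq by linarith
  qed
  have opp: "\<bar>sqrt x - sqrt y\<bar> \<le> 2 * sqrt \<bar>x - y\<bar>" if "0 \<le> x" "y \<le> 0" for x y :: real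
  proof -
    have "sqrt x \<le> sqrt (x - y)" "sqrt (- y) \<le> sqrt (x - y)" "0 \<le> sqrt x" "0 \<le> sqrt (- y)"
      using that by auto
    moreover have eq: "\<bar>sqrt x - sqrt y\<bar> = sqrt x + sqrt (- y)" "\<bar>x - y\<bar> = x - y"
      using calculation that by (auto simp: real_sqrt_minus)
    ultimately show ?thesis
      unfolding eq by linarith
  qed
  consider "0 \<le> a" "0 \<le> b" | "0 \<le> a" "b \<le> 0" | "a \<le> 0" "0 \<le> b" | "a \<le> 0" "b \<le> 0"
    by linarith
  then show ?thesis
  proof cases
    case 1 then show ?thesis by (rule same)
  next
    case 2 then show ?thesis by (rule opp)
  next
    case 3 then show ?thesis using opp[of b a] by (simp add: abs_minus_commute)
  next
    case 4
    then show ?thesis using same[of "- a" "- b"] by (simp add: real_sqrt_minus abs_minus_commute)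
  qed
qed

text \<open>The difference of the discriminants is at most a size \<open>?U\<close> times an
  increment \<open>?V\<close>, and \<open>2 * sqrt (?U * ?V)\<close> splits into
  \<open>e * ?U + ?V / e\<close> by the arithmetic-geometric mean inequality. The weight
  \<open>e\<close> is free: it makes the first part small, after which the second tends to zero.
  Later \<open>a\<close>, \<open>b\<close>, \<open>c\<close> are cell averages and \<open>x\<close>,
  \<open>y\<close>, \<open>z\<close> point values.\<close>

lemma sqrt_discriminant_diff_le:
  fixes a b c x y z e :: real
  assumes "0 < e"
  shows "\<bar>sqrt (a * b - c\<^sup>2) - sqrt (x * y - z\<^sup>2)\<bar>
    \<le> e * (\<bar>a\<bar> + \<bar>y\<bar> + \<bar>c\<bar> + \<bar>z\<bar>) + (\<bar>x - a\<bar> + \<bar>y - b\<bar> + \<bar>z - c\<bar>) / e"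
    (is "_ \<le> e * ?U + ?V / e")
proof -
  \<comment> \<open>Telescoping through the mixed product \<open>a * y\<close>, so that each summand
    carries exactly one increment.\<close>
  have "(a * b - c\<^sup>2) - (x * y - z\<^sup>2) = a * (b - y) + y * (a - x) + (c + z) * (z - c)"
    by (simp add: algebra_simps power2_eq_square)
  also have "\<bar>\<dots>\<bar> \<le> \<bar>a\<bar> * \<bar>y - b\<bar> + \<bar>y\<bar> * \<bar>x - a\<bar> + (\<bar>c\<bar> + \<bar>z\<bar>) * \<bar>z - c\<bar>"
  proof -
    have "\<bar>(c + z) * (z - c)\<bar> \<le> (\<bar>c\<bar> + \<bar>z\<bar>) * \<bar>z - c\<bar>"
      by (simp add: abs_mult mult_right_mono)
    moreover have "\<bar>a * (b - y)\<bar> = \<bar>a\<bar> * \<bar>y - b\<bar>" "\<bar>y * (a - x)\<bar> = \<bar>y\<bar> * \<bar>x - a\<bar>"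
      by (simp_all add: abs_mult abs_minus_commute)
    ultimately show ?thesis
      by (metis (no_types, lifting) abs_triangle_ineq add_mono order_refl order_trans)
  qed
  also have "\<dots> \<le> ?U * \<bar>y - b\<bar> + ?U * \<bar>x - a\<bar> + ?U * \<bar>z - c\<bar>"
    by (intro add_mono mult_right_mono) auto
  also have "\<dots> = ?U * ?V"
    by (simp only: distrib_left add.commute)
  also have "\<dots> = (e * ?U) * (?V / e)"
    using assms by simp
  finally have "\<bar>(a * b - c\<^sup>2) - (x * y - z\<^sup>2)\<bar> \<le> (e * ?U) * (?V / e)" .
  then have "2 * sqrt \<bar>(a * b - c\<^sup>2) - (x * y - z\<^sup>2)\<bar> \<le> 2 * sqrt ((e * ?U) * (?V / e))"
    by simp
  also have "\<dots> \<le> e * ?U + ?V / e"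
    using assms arith_geo_mean_sqrt[of "e * ?U" "?V / e"] by simp
  finally show ?thesis
    by (rule order_trans[OF abs_sqrt_diff_le])
qed

text \<open>Comparison with the zero triple at \<open>e = 1\<close>; it supplies an integrable
  majorant for the pointwise root.\<close>

lemma abs_sqrt_discriminant_le:
  fixes x y z :: real
  shows "\<bar>sqrt (x * y - z\<^sup>2)\<bar> \<le> 2 * (\<bar>x\<bar> + \<bar>y\<bar> + \<bar>z\<bar>)"
  using sqrt_discriminant_diff_le[of 1 0 0 0 x y z] by simp

lemma integrable_sqrt_discriminant:
  fixes F Z Q :: "'a \<Rightarrow> real"
  assumes int: "integrable N F" "integrable N Z" "integrable N Q"
  shows "integrable N (\<lambda>x. sqrt (F x * Z x - (Q x)\<^sup>2))"
proof (rule Bochner_Integration.integrable_bound)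
  show "integrable N (\<lambda>x. 2 * (\<bar>F x\<bar> + \<bar>Z x\<bar> + \<bar>Q x\<bar>))"
    using int by auto
  show "AE x in N. norm (sqrt (F x * Z x - (Q x)\<^sup>2)) \<le> norm (2 * (\<bar>F x\<bar> + \<bar>Z x\<bar> + \<bar>Q x\<bar>))"
  proof (rule AE_I2)
    fix x
    show "norm (sqrt (F x * Z x - (Q x)\<^sup>2)) \<le> norm (2 * (\<bar>F x\<bar> + \<bar>Z x\<bar> + \<bar>Q x\<bar>))"
      using abs_sqrt_discriminant_le[of "F x" "Z x" "Q x"] by simp
  qed
qed (use int[THEN borel_measurable_integrable] in measurable)

section \<open>Averages and mean oscillation over finite families of cells\<close>

locale partition_sequence = prob_space N for N :: "'a measure" +
  fixes J :: "nat \<Rightarrow> 'i set" and S :: "nat \<Rightarrow> 'i \<Rightarrow> 'a set"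
  assumes finite_index: "finite (J n)"
    and sets_cell [measurable]: "i \<in> J n \<Longrightarrow> S n i \<in> sets N"
    and disjoint_cells: "disjoint_family_on (S n) (J n)"
    and cell_pos: "i \<in> J n \<Longrightarrow> 0 < prob (S n i)"
begin

definition avg :: "nat \<Rightarrow> ('a \<Rightarrow> real) \<Rightarrow> 'i \<Rightarrow> real" where
  "avg n F i = (LINT x:S n i|N. F x) / prob (S n i)"

text \<open>For integrable \<open>F\<close> this is the L1 distance, over the union of the cells,
  between \<open>F\<close> and its conditional expectation given the cells. Cells for different
  \<open>n\<close> need not refine one another, so convergence is shown through this quantity and
  not as a martingale limit.\<close>

definition osc :: "nat \<Rightarrow> ('a \<Rightarrow> real) \<Rightarrow> real" where
  "osc n F = (\<Sum>i\<in>J n. LINT x:S n i|N. \<bar>F x - avg n F i\<bar>)"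

lemma set_integrable_cell:
  fixes F :: "'a \<Rightarrow> real"
  assumes "integrable N F" "i \<in> J n"
  shows "set_integrable N (S n i) F"
  using assms unfolding set_integrable_def by (intro integrable_mult_indicator sets_cell)

lemma set_integral_const_cell:
  assumes "i \<in> J n"
  shows "(LINT x:S n i|N. c) = c * prob (S n i)"
  using assms unfolding set_lebesgue_integral_def by simp

text \<open>Only an inequality, since the cells need not exhaust the space.\<close>

lemma sum_cells_le_integral:
  fixes F :: "'a \<Rightarrow> real"
  assumes "integrable N F" "\<And>x. 0 \<le> F x"
  shows "(\<Sum>i\<in>J n. LINT x:S n i|N. F x) \<le> (\<integral>x. F x \<partial>N)"
proof -
  have "(\<Sum>i\<in>J n. LINT x:S n i|N. F x) = (LINT x:(\<Union>i\<in>J n. S n i)|N. F x)"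
    using assms finite_index disjoint_cells
    by (intro set_integral_finite_Union[symmetric]) (auto simp: set_integrable_cell sets_cell)
  also have "\<dots> \<le> (\<integral>x. F x \<partial>N)"
    unfolding set_lebesgue_integral_def using assms finite_index
    by (intro integral_mono integrable_mult_indicator sets.finite_UN) (auto simp: indicator_def sets_cell)
  finally show ?thesis .
qed

lemma cell_integral_avg:
  assumes "i \<in> J n"
  shows "(LINT x:S n i|N. F x) = avg n F i * prob (S n i)"
  using cell_pos[OF assms] by (simp add: avg_def)

lemma sum_abs_avg_le:
  assumes "integrable N F"
  shows "(\<Sum>i\<in>J n. \<bar>avg n F i\<bar> * prob (S n i)) \<le> (\<integral>x. \<bar>F x\<bar> \<partial>N)"
proof -
  have "\<bar>avg n F i\<bar> * prob (S n i) \<le> (LINT x:S n i|N. \<bar>F x\<bar>)" if "i \<in> J n" for i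
  proof -
    have "\<bar>avg n F i\<bar> * prob (S n i) = \<bar>LINT x:S n i|N. F x\<bar>"
      using cell_pos[OF that] by (simp add: avg_def)
    also have "\<dots> \<le> (LINT x:S n i|N. \<bar>F x\<bar>)"
      unfolding set_lebesgue_integral_def
      by (rule order_trans[OF integral_abs_bound]) (simp add: abs_mult)
    finally show ?thesis .
  qed
  then have "(\<Sum>i\<in>J n. \<bar>avg n F i\<bar> * prob (S n i)) \<le> (\<Sum>i\<in>J n. LINT x:S n i|N. \<bar>F x\<bar>)"
    by (rule sum_mono)
  also have "\<dots> \<le> (\<integral>x. \<bar>F x\<bar> \<partial>N)"
    using assms by (intro sum_cells_le_integral) auto
  finally show ?thesis .
qed

lemma osc_nonneg: "0 \<le> osc n F"
  unfolding osc_def set_lebesgue_integral_def by (intro sum_nonneg integral_nonneg) auto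

lemma set_integrable_osc:
  fixes F :: "'a \<Rightarrow> real"
  assumes "integrable N F" "i \<in> J n"
  shows "set_integrable N (S n i) (\<lambda>x. \<bar>F x - c\<bar>)"
  using assms by (intro set_integrable_cell integrable_abs Bochner_Integration.integrable_diff) auto

lemma osc_add:
  assumes "integrable N F" "integrable N G"
  shows "osc n (\<lambda>x. F x + G x) \<le> osc n F + osc n G"
proof -
  have avg: "avg n (\<lambda>x. F x + G x) i = avg n F i + avg n G i" if "i \<in> J n" for i
    using that assms by (simp add: avg_def set_integral_add set_integrable_cell add_divide_distrib)
  have "(LINT x:S n i|N. \<bar>F x + G x - avg n (\<lambda>x. F x + G x) i\<bar>)
      \<le> (LINT x:S n i|N. \<bar>F x - avg n F i\<bar>) + (LINT x:S n i|N. \<bar>G x - avg n G i\<bar>)"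
    if i: "i \<in> J n" for i
  proof -
    have "(LINT x:S n i|N. \<bar>F x + G x - avg n (\<lambda>x. F x + G x) i\<bar>)
        \<le> (LINT x:S n i|N. \<bar>F x - avg n F i\<bar> + \<bar>G x - avg n G i\<bar>)"
      using i assms
      by (intro set_integral_mono set_integrable_osc set_integrable_cell) (auto simp: avg)
    also have "\<dots> = (LINT x:S n i|N. \<bar>F x - avg n F i\<bar>) + (LINT x:S n i|N. \<bar>G x - avg n G i\<bar>)"
      using i assms by (intro set_integral_add set_integrable_osc)
    finally show ?thesis .
  qed
  then show ?thesis
    unfolding osc_def sum.distrib[symmetric] by (rule sum_mono)
qed

lemma osc_cmult: "osc n (\<lambda>x. c * F x) = \<bar>c\<bar> * osc n F"
proof -
  have "\<bar>c * F x - avg n (\<lambda>x. c * F x) i\<bar> = \<bar>c\<bar> * \<bar>F x - avg n F i\<bar>" for i x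
    by (simp add: avg_def abs_mult[symmetric] right_diff_distrib)
  then show ?thesis
    by (simp add: osc_def sum_distrib_left)
qed

text \<open>The triangle inequality and the L1 contraction property of averaging each give one norm.
  The bound is uniform in \<open>n\<close>, which makes oscillation stable under L1
  approximation.\<close>

lemma osc_le:
  assumes "integrable N F"
  shows "osc n F \<le> 2 * (\<integral>x. \<bar>F x\<bar> \<partial>N)"
proof -
  have "osc n F \<le> (\<Sum>i\<in>J n. (LINT x:S n i|N. \<bar>F x\<bar>) + \<bar>avg n F i\<bar> * prob (S n i))"
    unfolding osc_def
  proof (rule sum_mono)
    fix i assume i: "i \<in> J n"
    have "(LINT x:S n i|N. \<bar>F x - avg n F i\<bar>) \<le> (LINT x:S n i|N. \<bar>F x\<bar> + \<bar>avg n F i\<bar>)"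
      using i assms by (intro set_integral_mono set_integrable_osc set_integrable_cell) auto
    also have "\<dots> = (LINT x:S n i|N. \<bar>F x\<bar>) + (LINT x:S n i|N. \<bar>avg n F i\<bar>)"
      using i assms by (intro set_integral_add set_integrable_cell) auto
    finally show "(LINT x:S n i|N. \<bar>F x - avg n F i\<bar>)
        \<le> (LINT x:S n i|N. \<bar>F x\<bar>) + \<bar>avg n F i\<bar> * prob (S n i)"
      using i by (simp add: set_integral_const_cell)
  qed
  also have "\<dots> \<le> (\<integral>x. \<bar>F x\<bar> \<partial>N) + (\<integral>x. \<bar>F x\<bar> \<partial>N)"
    unfolding sum.distrib using assms by (intro add_mono sum_cells_le_integral sum_abs_avg_le) auto
  finally show ?thesis
    by simp
qed

text \<open>Oscillation is subadditive and bounded by twice the L1 norm uniformly in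
  \<open>n\<close>, so the functions with vanishing oscillation form an L1-closed set.\<close>

lemma osc_tendsto_0_limit:
  assumes F: "integrable N F" and s: "\<And>k. integrable N (s k)" "\<And>k. (\<lambda>n. osc n (s k)) \<longlonglongrightarrow> 0"
    and lim: "(\<lambda>k. \<integral>x. \<bar>F x - s k x\<bar> \<partial>N) \<longlonglongrightarrow> 0"
  shows "(\<lambda>n. osc n F) \<longlonglongrightarrow> 0"
proof (rule LIMSEQ_I)
  fix e :: real assume e: "0 < e"
  \<comment> \<open>\<open>osc_le\<close> doubles this error, so \<open>e / 4\<close> leaves room
    for \<open>e / 2\<close>.\<close>
  obtain k where k: "(\<integral>x. \<bar>F x - s k x\<bar> \<partial>N) < e / 4"
    using order_tendstoD(2)[OF lim, of "e / 4"] e by (auto dest: eventually_happens)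
  obtain n0 where n0: "\<And>n. n \<ge> n0 \<Longrightarrow> osc n (s k) < e / 2"
    using order_tendstoD(2)[OF s(2)[of k], of "e / 2"] e by (auto simp: eventually_sequentially)
  have "osc n F < e" if "n \<ge> n0" for n
  proof -
    have "osc n F = osc n (\<lambda>x. s k x + (F x - s k x))"
      by simp
    also have "\<dots> \<le> osc n (s k) + osc n (\<lambda>x. F x - s k x)"
      using F s by (intro osc_add) auto
    also have "osc n (\<lambda>x. F x - s k x) \<le> 2 * (\<integral>x. \<bar>F x - s k x\<bar> \<partial>N)"
      using F s by (intro osc_le) auto
    finally show ?thesis
      using k n0[OF that] by linarith
  qed
  then show "\<exists>n0. \<forall>n\<ge>n0. norm (osc n F - 0) < e"
    using osc_nonneg by (auto intro!: exI[of _ n0])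
qed

text \<open>Sets whose indicators have vanishing oscillation form a Dynkin system: constants have
  oscillation zero, which settles complements, and the indicator of a disjoint union is an L1 limit
  of partial sums.\<close>

lemma osc_indicator_tendsto_0:
  assumes G: "Int_stable G" "sets N = sigma_sets (space N) G" "G \<subseteq> Pow (space N)"
    and basic: "\<And>B. B \<in> G \<Longrightarrow> (\<lambda>n. osc n (indicator B)) \<longlonglongrightarrow> 0"
    and B: "B \<in> sets N"
  shows "(\<lambda>n. osc n (indicator B)) \<longlonglongrightarrow> 0"
  using G(1,3) B[unfolded G(2)]
proof (induction B rule: sigma_sets_induct_disjoint)
  case (basic B)
  then show ?case by (rule assms(4))
next
  case empty
  show ?case by (simp add: osc_def avg_def)
next
  case (compl B)
  then have B: "B \<in> sets N"
    using G by simp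
  have "osc n (indicator (space N - B)) \<le> osc n (indicator B)" for n
  proof -
    \<comment> \<open>The two functions agree only on \<open>space N\<close>, so the congruence is
      applied beneath every integral, including the one inside \<open>avg\<close>.\<close>
    have "osc n (indicator (space N - B)) = osc n (\<lambda>x. 1 + (- 1) * indicator B x)"
      unfolding osc_def avg_def set_lebesgue_integral_def
      by (intro sum.cong refl Bochner_Integration.integral_cong arg_cong2[where f="(*\<^sub>R)"]
          arg_cong[where f=abs] arg_cong2[where f="(-)"] arg_cong2[where f="(/)"])
        (auto simp: indicator_def)
    also have "\<dots> \<le> osc n (\<lambda>x. 1) + osc n (\<lambda>x. (- 1) * indicator B x)"
      using B by (intro osc_add) (auto intro!: integrable_real_indicator simp: emeasure_eq_measure)
    also have "osc n (\<lambda>x. 1) = 0"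
      unfolding osc_def avg_def
    proof (intro sum.neutral ballI)
      fix i assume "i \<in> J n"
      then show "(LINT x:S n i|N. \<bar>1 - (LINT x:S n i|N. 1) / prob (S n i)\<bar>) = 0"
        using cell_pos[of i n] by (simp add: set_integral_const_cell)
    qed
    also have "osc n (\<lambda>x. (- 1) * indicator B x) = osc n (indicator B)"
      using osc_cmult[of n "- 1" "indicator B"] by simp
    finally show ?thesis
      by simp
  qed
  then show ?case
    using compl.IH by (intro tendsto_sandwich[OF _ _ tendsto_const compl.IH]) (auto simp: osc_nonneg)
next
  case (union A)
  have A [measurable]: "A k \<in> sets N" for k
    using union.hyps G by auto
  \<comment> \<open>The partial sums are indicators of finite unions. Their differences from the
    full indicator thus lie between 0 and 1, and dominated convergence applies with the constant
    1.\<close>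
  let ?s = "\<lambda>k x. \<Sum>j<k. indicator (A j) x :: real"
  have s_le: "?s k x \<le> indicator (\<Union>j. A j) x" for k x
  proof -
    have "?s k x = indicator (\<Union>j\<in>{..<k}. A j) x"
      using union.hyps(1)
      by (intro indicator_UN_disjoint[symmetric])
        (auto simp: disjoint_family_on_def)
    also have "\<dots> \<le> indicator (\<Union>j. A j) x"
      by (auto simp: indicator_def)
    finally show ?thesis .
  qed
  have int: "integrable N (?s k)" for k
    by (auto intro!: integrable_real_indicator simp: emeasure_eq_measure)
  show ?case
  proof (rule osc_tendsto_0_limit[where s="?s"])
    show "integrable N (indicat_real (\<Union> (range A)))"
      by (intro integrable_real_indicator) (auto simp: emeasure_eq_measure)
    show "integrable N (?s k)" for k by (rule int)
    show "(\<lambda>n. osc n (?s k)) \<longlonglongrightarrow> 0" for k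
    proof (induction k)
      case 0
      show ?case by (simp add: osc_def avg_def)
    next
      case (Suc k)
      have lim: "(\<lambda>n. osc n (?s k) + osc n (indicator (A k))) \<longlonglongrightarrow> 0"
        using tendsto_add[OF Suc union.IH[of k]] by simp
      show ?case
      proof (rule tendsto_sandwich[OF _ _ tendsto_const lim])
        show "\<forall>\<^sub>F n in sequentially. osc n (?s (Suc k)) \<le> osc n (?s k) + osc n (indicator (A k))"
          unfolding sum.lessThan_Suc
          by (intro always_eventually allI osc_add int integrable_real_indicator A)
            (simp add: emeasure_eq_measure)
      qed (simp add: osc_nonneg)
    qed
    show "(\<lambda>k. \<integral>x. \<bar>indicator (\<Union> (range A)) x - ?s k x\<bar> \<partial>N) \<longlonglongrightarrow> 0"
    proof -
      have "(\<lambda>k. \<integral>x. \<bar>indicator (\<Union> (range A)) x - ?s k x\<bar> \<partial>N) \<longlonglongrightarrow> (\<integral>x. 0 \<partial>N)"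
      proof (rule integral_dominated_convergence[where w="\<lambda>x. 1"])
        show "AE x in N. (\<lambda>k. \<bar>indicator (\<Union> (range A)) x - ?s k x\<bar>) \<longlonglongrightarrow> 0"
        proof (rule AE_I2)
          fix x
          have "(\<lambda>j. indicator (A j) x :: real) sums indicator (\<Union> (range A)) x"
            using union.hyps(1) by (intro indicator_sums) (auto simp: disjoint_family_on_def)
          then have "(\<lambda>k. ?s k x) \<longlonglongrightarrow> indicator (\<Union> (range A)) x"
            by (simp add: sums_def)
          then have "(\<lambda>k. \<bar>indicator (\<Union> (range A)) x - ?s k x\<bar>)
              \<longlonglongrightarrow> \<bar>indicator (\<Union> (range A)) x - indicator (\<Union> (range A)) x\<bar>"
            by (rule tendsto_rabs[OF tendsto_diff[OF tendsto_const]])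
          then show "(\<lambda>k. \<bar>indicator (\<Union> (range A)) x - ?s k x\<bar>) \<longlonglongrightarrow> 0"
            by simp
        qed
        show "AE x in N. norm \<bar>indicator (\<Union> (range A)) x - ?s k x\<bar> \<le> 1" for k
        proof (rule AE_I2)
          fix x
          have "0 \<le> ?s k x"
            by (intro sum_nonneg) auto
          moreover have "indicat_real (\<Union> (range A)) x \<le> 1"
            by simp
          ultimately have "0 \<le> indicat_real (\<Union> (range A)) x - ?s k x"
              "indicat_real (\<Union> (range A)) x - ?s k x \<le> 1"
            using s_le[of x k] by linarith+
          then show "norm \<bar>indicator (\<Union> (range A)) x - ?s k x\<bar> \<le> 1"
            by (simp only: real_norm_def abs_abs abs_of_nonneg)
        qed
      qed auto
      then show ?thesis by simp
    qed
  qed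
qed

lemma osc_tendsto_0:
  assumes G: "Int_stable G" "sets N = sigma_sets (space N) G" "G \<subseteq> Pow (space N)"
    and basic: "\<And>B. B \<in> G \<Longrightarrow> (\<lambda>n. osc n (indicator B)) \<longlonglongrightarrow> 0"
    and F: "integrable N F"
  shows "(\<lambda>n. osc n F) \<longlonglongrightarrow> 0"
  using F
proof (induction F rule: integrable_induct)
  case (base A c)
  then show ?case
    using tendsto_mult_left[OF osc_indicator_tendsto_0[OF G basic, of A], of "\<bar>c\<bar>"]
      osc_cmult[of _ c "indicator A"] by (simp add: mult.commute)
next
  case (add F H)
  have lim: "(\<lambda>n. osc n F + osc n H) \<longlonglongrightarrow> 0"
    using tendsto_add[OF add.IH] by simp
  show ?case
  proof (rule tendsto_sandwich[OF _ _ tendsto_const lim])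
    show "\<forall>\<^sub>F n in sequentially. osc n (\<lambda>x. F x + H x) \<le> osc n F + osc n H"
      using add.hyps by (intro always_eventually allI osc_add)
  qed (simp add: osc_nonneg)
next
  case (lim F s)
  show ?case
  proof (rule osc_tendsto_0_limit[where s=s, OF lim.hyps(4,1) lim.IH])
    have "(\<lambda>k. \<integral>x. \<bar>F x - s k x\<bar> \<partial>N) \<longlonglongrightarrow> (\<integral>x. 0 \<partial>N)"
    \<comment> \<open>The approximants satisfy
      \<open>\<bar>s k x\<bar> \<le> 2 * \<bar>F x\<bar>\<close>, hence the factor 3.\<close>
    proof (rule integral_dominated_convergence[where w="\<lambda>x. 3 * \<bar>F x\<bar>"])
      show "AE x in N. (\<lambda>k. \<bar>F x - s k x\<bar>) \<longlonglongrightarrow> 0"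
        using lim.hyps(2) by (intro AE_I2) (auto intro!: tendsto_eq_intros)
      show "AE x in N. norm \<bar>F x - s k x\<bar> \<le> 3 * \<bar>F x\<bar>" for k
      proof (rule AE_I2)
        fix x assume "x \<in> space N"
        from lim.hyps(3)[OF this, of k] show "norm \<bar>F x - s k x\<bar> \<le> 3 * \<bar>F x\<bar>"
          by auto
      qed
    qed (use lim.hyps(1,4) in auto)
    then show "(\<lambda>k. \<integral>x. \<bar>F x - s k x\<bar> \<partial>N) \<longlonglongrightarrow> 0"
      by simp
  qed
qed

text \<open>Within a cell the discriminant of the integrals is that of the averages times the
  squared mass. Its root is therefore the integral of a constant, and
  \<open>sqrt_discriminant_diff_le\<close> can be integrated over the cell. In the first part
  \<open>F\<close> enters through its averages, \<open>Z\<close> pointwise and \<open>Q\<close> in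
  both ways, hence the factor 2.\<close>

lemma cell_sqrt_discriminant_bound:
  assumes int: "integrable N F" "integrable N Z" "integrable N Q" and e: "0 < e"
  shows "(\<Sum>i\<in>J n. \<bar>sqrt ((LINT x:S n i|N. F x) * (LINT x:S n i|N. Z x) - (LINT x:S n i|N. Q x)\<^sup>2)
            - (LINT x:S n i|N. sqrt (F x * Z x - (Q x)\<^sup>2))\<bar>)
    \<le> e * ((\<integral>x. \<bar>F x\<bar> \<partial>N) + (\<integral>x. \<bar>Z x\<bar> \<partial>N) + 2 * (\<integral>x. \<bar>Q x\<bar> \<partial>N))
       + (osc n F + osc n Z + osc n Q) / e"
proof -
  let ?H = "\<lambda>x. sqrt (F x * Z x - (Q x)\<^sup>2)"
  have H: "integrable N ?H"
    using int by (rule integrable_sqrt_discriminant)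
  have "\<bar>sqrt ((LINT x:S n i|N. F x) * (LINT x:S n i|N. Z x) - (LINT x:S n i|N. Q x)\<^sup>2)
            - (LINT x:S n i|N. ?H x)\<bar>
      \<le> e * (\<bar>avg n F i\<bar> * prob (S n i) + (LINT x:S n i|N. \<bar>Z x\<bar>)
            + (\<bar>avg n Q i\<bar> * prob (S n i) + (LINT x:S n i|N. \<bar>Q x\<bar>)))
        + ((LINT x:S n i|N. \<bar>F x - avg n F i\<bar>) + (LINT x:S n i|N. \<bar>Z x - avg n Z i\<bar>)
            + (LINT x:S n i|N. \<bar>Q x - avg n Q i\<bar>)) / e" if i: "i \<in> J n" for i
  proof -
    let ?c = "sqrt (avg n F i * avg n Z i - (avg n Q i)\<^sup>2)"
    have "(LINT x:S n i|N. F x) * (LINT x:S n i|N. Z x) - (LINT x:S n i|N. Q x)\<^sup>2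
        = (avg n F i * avg n Z i - (avg n Q i)\<^sup>2) * (prob (S n i))\<^sup>2"
      using i by (simp add: cell_integral_avg algebra_simps power2_eq_square)
    then have "sqrt ((LINT x:S n i|N. F x) * (LINT x:S n i|N. Z x) - (LINT x:S n i|N. Q x)\<^sup>2)
        = (LINT x:S n i|N. ?c)"
      using i by (simp add: set_integral_const_cell real_sqrt_mult)
    then have "\<bar>sqrt ((LINT x:S n i|N. F x) * (LINT x:S n i|N. Z x) - (LINT x:S n i|N. Q x)\<^sup>2)
            - (LINT x:S n i|N. ?H x)\<bar> = \<bar>LINT x:S n i|N. ?c - ?H x\<bar>"
      using i H by (simp add: set_integral_diff set_integrable_cell)
    also have "\<dots> \<le> (LINT x:S n i|N. \<bar>?c - ?H x\<bar>)"
      unfolding set_lebesgue_integral_def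
      by (rule order_trans[OF integral_abs_bound]) (simp add: abs_mult)
    also have "\<dots> \<le> (LINT x:S n i|N. e * (\<bar>avg n F i\<bar> + \<bar>Z x\<bar> + (\<bar>avg n Q i\<bar> + \<bar>Q x\<bar>))
        + (\<bar>F x - avg n F i\<bar> + \<bar>Z x - avg n Z i\<bar> + \<bar>Q x - avg n Q i\<bar>) / e)"
    proof (intro set_integral_mono set_integrable_cell i)
      fix x
      show "\<bar>?c - ?H x\<bar> \<le> e * (\<bar>avg n F i\<bar> + \<bar>Z x\<bar> + (\<bar>avg n Q i\<bar> + \<bar>Q x\<bar>))
        + (\<bar>F x - avg n F i\<bar> + \<bar>Z x - avg n Z i\<bar> + \<bar>Q x - avg n Q i\<bar>) / e"
        using sqrt_discriminant_diff_le[OF e, of "avg n F i" "avg n Z i" "avg n Q i" "F x" "Z x" "Q x"]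
        by (simp add: add.assoc)
    qed (use int H in auto)
    also have "\<dots> = e * (\<bar>avg n F i\<bar> * prob (S n i) + (LINT x:S n i|N. \<bar>Z x\<bar>)
            + (\<bar>avg n Q i\<bar> * prob (S n i) + (LINT x:S n i|N. \<bar>Q x\<bar>)))
        + ((LINT x:S n i|N. \<bar>F x - avg n F i\<bar>) + (LINT x:S n i|N. \<bar>Z x - avg n Z i\<bar>)
            + (LINT x:S n i|N. \<bar>Q x - avg n Q i\<bar>)) / e"
      using i int
      by (simp add: set_integral_add set_integrable_cell set_integral_const_cell)
    finally show ?thesis .
  qed
  then have "(\<Sum>i\<in>J n. \<bar>sqrt ((LINT x:S n i|N. F x) * (LINT x:S n i|N. Z x) - (LINT x:S n i|N. Q x)\<^sup>2)
            - (LINT x:S n i|N. ?H x)\<bar>)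
      \<le> (\<Sum>i\<in>J n. e * (\<bar>avg n F i\<bar> * prob (S n i) + (LINT x:S n i|N. \<bar>Z x\<bar>)
            + (\<bar>avg n Q i\<bar> * prob (S n i) + (LINT x:S n i|N. \<bar>Q x\<bar>)))
        + ((LINT x:S n i|N. \<bar>F x - avg n F i\<bar>) + (LINT x:S n i|N. \<bar>Z x - avg n Z i\<bar>)
            + (LINT x:S n i|N. \<bar>Q x - avg n Q i\<bar>)) / e)"
    by (rule sum_mono)
  also have "\<dots> = e * ((\<Sum>i\<in>J n. \<bar>avg n F i\<bar> * prob (S n i)) + (\<Sum>i\<in>J n. LINT x:S n i|N. \<bar>Z x\<bar>)
            + ((\<Sum>i\<in>J n. \<bar>avg n Q i\<bar> * prob (S n i)) + (\<Sum>i\<in>J n. LINT x:S n i|N. \<bar>Q x\<bar>)))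
       + (osc n F + osc n Z + osc n Q) / e"
    by (simp add: sum.distrib sum_distrib_left[symmetric] sum_divide_distrib[symmetric] osc_def)
  also have "\<dots> \<le> e * ((\<integral>x. \<bar>F x\<bar> \<partial>N) + (\<integral>x. \<bar>Z x\<bar> \<partial>N) + ((\<integral>x. \<bar>Q x\<bar> \<partial>N) + (\<integral>x. \<bar>Q x\<bar> \<partial>N)))
       + (osc n F + osc n Z + osc n Q) / e"
    using int e
    by (intro add_right_mono mult_left_mono add_mono sum_abs_avg_le sum_cells_le_integral) auto
  finally show ?thesis
    by simp
qed

lemma cell_sqrt_discriminant_tendsto:
  assumes int: "integrable N F" "integrable N Z" "integrable N Q"
    and osc: "(\<lambda>n. osc n F) \<longlonglongrightarrow> 0" "(\<lambda>n. osc n Z) \<longlonglongrightarrow> 0" "(\<lambda>n. osc n Q) \<longlonglongrightarrow> 0"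
  shows "(\<lambda>n. \<Sum>i\<in>J n.
      \<bar>sqrt ((LINT x:S n i|N. F x) * (LINT x:S n i|N. Z x) - (LINT x:S n i|N. Q x)\<^sup>2)
        - (LINT x:S n i|N. sqrt (F x * Z x - (Q x)\<^sup>2))\<bar>) \<longlonglongrightarrow> 0" (is "?D \<longlonglongrightarrow> 0")
proof (rule LIMSEQ_I)
  fix e :: real assume e: "0 < e"
  define K where "K = (\<integral>x. \<bar>F x\<bar> \<partial>N) + (\<integral>x. \<bar>Z x\<bar> \<partial>N) + 2 * (\<integral>x. \<bar>Q x\<bar> \<partial>N)"
  \<comment> \<open>The weight is fixed before \<open>n\<close> grows; adding 1 keeps the
    denominator positive when \<open>K = 0\<close>.\<close>
  define d where "d = e / (2 * (K + 1))"
  have K: "0 \<le> K"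
    unfolding K_def by (intro add_nonneg_nonneg mult_nonneg_nonneg integral_nonneg) auto
  then have d: "0 < d" "d * K < e / 2"
    using e by (auto simp: d_def field_simps)
  have "(\<lambda>n. (osc n F + osc n Z + osc n Q) / d) \<longlonglongrightarrow> (0 + 0 + 0) / d"
    by (intro tendsto_intros osc) (use d in auto)
  then have "\<forall>\<^sub>F n in sequentially. (osc n F + osc n Z + osc n Q) / d < e / 2"
    using e by (intro order_tendstoD(2)) auto
  then obtain n0 where n0: "\<And>n. n \<ge> n0 \<Longrightarrow> (osc n F + osc n Z + osc n Q) / d < e / 2"
    by (auto simp: eventually_sequentially)
  have "?D n < e" if "n \<ge> n0" for n
    using cell_sqrt_discriminant_bound[OF int d(1), of n] n0[OF that] d(2)
    unfolding K_def[symmetric] by linarith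
  moreover have "0 \<le> ?D n" for n
    by (intro sum_nonneg) auto
  ultimately show "\<exists>n0. \<forall>n\<ge>n0. norm (?D n - 0) < e"
    by (auto intro!: exI[of _ n0])
qed

end

subsection \<open>Quantile strata\<close>

lemma real_distribution_prob_density:
  assumes "prob_density h"
  shows "real_distribution (density lborel (\<lambda>t. ennreal (h t)))"
proof -
  have [measurable]: "h \<in> borel_measurable borel"
    using assms by (simp add: prob_density_def)
  have "prob_space (density lborel (\<lambda>t. ennreal (h t)))"
    using assms by (intro prob_spaceI) (simp add: emeasure_density prob_density_def)
  then show ?thesis
    by (simp add: real_distribution_def real_distribution_axioms_def)
qed

lemma isCont_cdf_density:
  assumes "prob_density h"
  shows "isCont (cdf (density lborel (\<lambda>t. ennreal (h t)))) x"
proof -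
  interpret real_distribution "density lborel (\<lambda>t. ennreal (h t))"
    using assms by (rule real_distribution_prob_density)
  have [measurable]: "h \<in> borel_measurable borel"
    using assms by (simp add: prob_density_def)
  have "emeasure (density lborel (\<lambda>t. ennreal (h t))) {x} = 0"
    by (subst emeasure_density) (auto intro!: nn_integral_null_set)
  then show ?thesis
    by (simp add: isCont_cdf measure_def)
qed

text \<open>A law with a density has a continuous distribution function, so the level
  \<open>u\<close> is attained exactly. An infinite quantile occurs only at the levels 0 and 1,
  where the half-line is empty or everything.\<close>

lemma measure_atMost_quantile:
  assumes h: "prob_density h" and u: "0 \<le> u" "u \<le> 1"
  shows "measure (density lborel (\<lambda>t. ennreal (h t))) {x. ereal x \<le> quantile h u} = u"
proof -
  let ?M = "density lborel (\<lambda>t. ennreal (h t))"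
  interpret real_distribution ?M
    using h by (rule real_distribution_prob_density)
  let ?A = "{x. cdf ?M x > 0 \<and> cdf ?M x \<ge> u}"
  show ?thesis
  proof (cases "quantile h u")
    case PInf
    have "u = 1"
    proof (rule ccontr)
      assume "u \<noteq> 1"
      \<comment> \<open>A point enters the infimum if the distribution function there is positive
        and at least \<open>u\<close>; exceeding \<open>max u 0\<close> secures both.\<close>
      then have "max u 0 < 1"
        using u by simp
      then have "\<forall>\<^sub>F x in at_top. max u 0 < cdf ?M x"
        using cdf_lim_at_top_prob by (rule order_tendstoD(1)[rotated])
      then obtain x where "max u 0 < cdf ?M x"
        by (auto dest: eventually_happens)
      then have "quantile h u \<le> ereal x"
        unfolding quantile_def by (intro INF_lower) auto
      then show False
        using PInf by simp
    qed
    then show ?thesis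
      using PInf prob_space by simp
  next
    case MInf
    \<comment> \<open>\<open>?A\<close> has points below every real, so \<open>u\<close> is a lower
      bound of the distribution function, whose limit at minus infinity is 0.\<close>
    have "u \<le> cdf ?M x" for x
    proof -
      have "quantile h u < ereal x"
        using MInf by simp
      then obtain y where "y \<in> ?A" "y < x"
        unfolding quantile_def INF_less_iff by auto
      then show ?thesis
        using cdf_nondecreasing[of y x] by auto
    qed
    then have "u \<le> 0"
      using cdf_lim_at_bot by (intro tendsto_lowerbound[of "cdf ?M" 0 at_bot u]) auto
    then show ?thesis
      using u MInf by simp
  next
    case (real r)
    \<comment> \<open>By continuity the bound \<open>u \<le> cdf ?M x\<close> to the right of
      \<open>r\<close> and the bound \<open>cdf ?M x \<le> u\<close> to its left meet at
      \<open>r\<close>.\<close>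
    have cont: "(cdf ?M \<longlongrightarrow> cdf ?M r) (at r)"
      using isCont_cdf_density[OF h, of r] by (simp add: isCont_def)
    have "u \<le> cdf ?M x" if "r < x" for x
    proof -
      have "quantile h u < ereal x"
        using real that by simp
      then obtain y where "y \<in> ?A" "y < x"
        unfolding quantile_def INF_less_iff by auto
      then show ?thesis
        using cdf_nondecreasing[of y x] by auto
    qed
    then have "u \<le> cdf ?M r"
      using tendsto_within_subset[OF cont, of "{r<..}"]
      by (intro tendsto_lowerbound[of "cdf ?M" _ "at_right r"])
        (auto simp: eventually_at_filter)
    moreover have "cdf ?M x \<le> u" if "x < r" for x
    proof (rule ccontr)
      assume "\<not> cdf ?M x \<le> u"
      then have "quantile h u \<le> ereal x"
        unfolding quantile_def using u by (intro INF_lower) auto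
      then show False
        using real that by simp
    qed
    then have "cdf ?M r \<le> u"
      using tendsto_within_subset[OF cont, of "{..<r}"]
      by (intro tendsto_upperbound[of "cdf ?M" _ "at_left r"])
        (auto simp: eventually_at_filter)
    moreover have "{x. ereal x \<le> quantile h u} = {..r}"
      using real by auto
    ultimately show ?thesis
      by (simp add: cdf_def)
  qed
qed

lemma quantile_mono: "u \<le> v \<Longrightarrow> quantile h u \<le> quantile h v"
  unfolding quantile_def by (rule INF_superset_mono) auto

lemma measure_quantile_interval:
  assumes h: "prob_density h" and j: "1 \<le> j" "j \<le> n"
  shows "measure (density lborel (\<lambda>t. ennreal (h t)))
      {x. quantile h ((real j - 1) / real n) < ereal x \<and> ereal x \<le> quantile h (real j / real n)}
    = 1 / real n"
proof -
  let ?M = "density lborel (\<lambda>t. ennreal (h t))"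
  interpret real_distribution ?M
    using h by (rule real_distribution_prob_density)
  have le: "(real j - 1) / real n \<le> real j / real n"
    by (simp add: divide_right_mono)
  let ?B = "\<lambda>u. {x. ereal x \<le> quantile h u}"
  have "{x. quantile h ((real j - 1) / real n) < ereal x \<and> ereal x \<le> quantile h (real j / real n)}
      = ?B (real j / real n) - ?B ((real j - 1) / real n)"
    by auto
  then have "measure ?M {x. quantile h ((real j - 1) / real n) < ereal x \<and>
        ereal x \<le> quantile h (real j / real n)} = measure ?M (?B (real j / real n) - ?B ((real j - 1) / real n))"
    by simp
  also have "\<dots> = measure ?M (?B (real j / real n)) - measure ?M (?B ((real j - 1) / real n))"
    using quantile_mono[OF le, of h] by (intro finite_measure_Diff) auto
  also have "\<dots> = real j / real n - (real j - 1) / real n"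
    using j by (simp add: measure_atMost_quantile[OF h])
  finally show ?thesis
    by (simp add: diff_divide_distrib)
qed

lemma quantile_intervals_disjoint:
  assumes "quantile h ((real i - 1) / real n) < ereal x" "ereal x \<le> quantile h (real i / real n)"
    and "quantile h ((real j - 1) / real n) < ereal x" "ereal x \<le> quantile h (real j / real n)"
  shows "i = j"
proof -
  have *: False if "i < j" "ereal x \<le> quantile h (real i / real n)"
    "quantile h ((real j - 1) / real n) < ereal x" for i j :: nat
  proof -
    have "real i / real n \<le> (real j - 1) / real n"
      using that by (intro divide_right_mono) auto
    then show False
      using that quantile_mono[of "real i / real n" "(real j - 1) / real n" h] by auto
  qed
  show ?thesis
    using *[of i j] *[of j i] assms by (meson linorder_neqE_nat)
qed

section \<open>Measurability and counting of strata\<close>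

lemma sets_stratum [measurable]: "stratum g I i \<in> sets borel"
proof -
  have "stratum g I i = (\<Inter>k. {x. quantile (g k) ((real (i k) - 1) / real I) < ereal (x $ k)}
      \<inter> {x. ereal (x $ k) \<le> quantile (g k) (real (i k) / real I)})"
    by (auto simp: stratum_def)
  also have "\<dots> \<in> sets borel"
    by (intro sets.finite_INT) auto
  finally show ?thesis .
qed

lemma finite_strata_index [simp]: "finite (strata_index I)"
  by (simp add: strata_index_def finite_PiE)

lemma card_strata_index: "card (strata_index I :: ('m::finite \<Rightarrow> nat) set) = I ^ CARD('m)"
  by (simp add: strata_index_def card_PiE)

text \<open>Freezing one coordinate leaves \<open>CARD('m) - 1\<close> free ones. This bounds the
  number of strata cut by a hyperplane orthogonal to an axis. It is an inequality because a value
  \<open>c\<close> outside the range leaves no index.\<close>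

lemma card_strata_index_fixed:
  "card {i \<in> strata_index I :: ('m::finite \<Rightarrow> nat) set. i k = c} \<le> I ^ (CARD('m) - 1)"
proof -
  have "{i \<in> strata_index I :: ('m \<Rightarrow> nat) set. i k = c}
      \<subseteq> PiE UNIV (\<lambda>l. if l = k then {c} else {1..I})"
    by (auto simp: strata_index_def PiE_iff)
  then have "card {i \<in> strata_index I :: ('m \<Rightarrow> nat) set. i k = c}
      \<le> card (PiE (UNIV :: 'm set) (\<lambda>l. if l = k then {c} else {1..I}))"
    by (intro card_mono finite_PiE) auto
  also have "\<dots> = (\<Prod>l\<in>UNIV. if l = k then 1 else I)"
    by (simp add: card_PiE if_distrib cong: if_cong)
  also have "\<dots> = I ^ (CARD('m) - 1)"
    by (subst prod.remove[of _ k]) (auto simp: card_Diff_singleton)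
  finally show ?thesis .
qed

section \<open>The product measure and the mass of strata\<close>

definition product_density :: "('m::finite \<Rightarrow> real \<Rightarrow> real) \<Rightarrow> real ^ 'm \<Rightarrow> real" where
  "product_density g x = (\<Prod>k\<in>UNIV. g k (x $ k))"

definition product_measure :: "('m::finite \<Rightarrow> real \<Rightarrow> real) \<Rightarrow> (real ^ 'm) measure" where
  "product_measure g = density lborel (\<lambda>x. ennreal (product_density g x))"

lemma sets_product_measure [simp, measurable_cong]: "sets (product_measure g) = sets borel"
  and space_product_measure [simp]: "space (product_measure g) = UNIV"
  by (simp_all add: product_measure_def)

lemma product_density_nonneg:
  assumes "\<And>k. prob_density (g k)"
  shows "0 \<le> product_density g x"
  using assms by (auto simp: product_density_def prob_density_def intro!: prod_nonneg)

lemma measurable_product_density: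
  assumes "\<And>k. prob_density (g k)"
  shows "product_density g \<in> borel_measurable borel"
proof -
  have [measurable]: "g k \<in> borel_measurable borel" for k
    using assms by (simp add: prob_density_def)
  show ?thesis
    unfolding product_density_def by measurable
qed

text \<open>Tonelli for a product of one-dimensional functions. The product formula for
  \<open>lborel\<close> runs over the standard basis, so the coordinates are relabelled through
  \<open>axis k 1\<close> and the inverse map \<open>idx\<close>.\<close>

lemma emeasure_product_measure_box:
  fixes g :: "'m::finite \<Rightarrow> real \<Rightarrow> real"
  assumes g: "\<And>k. prob_density (g k)" and A: "\<And>k. A k \<in> sets borel"
  shows "emeasure (product_measure g) {x. \<forall>k. x $ k \<in> A k}
    = (\<Prod>k\<in>UNIV. emeasure (density lborel (\<lambda>t. ennreal (g k t))) (A k))"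
proof -
  have [measurable]: "g k \<in> borel_measurable borel" and nn: "0 \<le> g k t" for k t
    using g by (simp_all add: prob_density_def)
  note [measurable] = measurable_product_density[OF g] A
  let ?F = "\<lambda>k t. ennreal (g k t) * indicator (A k) t"
  have inj: "inj (\<lambda>k. axis k 1 :: real ^ 'm)"
    by (auto simp: inj_def axis_eq_axis)
  have Basis: "(Basis :: (real ^ 'm) set) = range (\<lambda>k. axis k 1)"
    by (auto simp: Basis_vec_def)
  define idx where "idx b = inv (\<lambda>k. axis k 1 :: real ^ 'm) b" for b
  have idx: "idx (axis k 1) = k" for k
    unfolding idx_def by (rule inv_f_f[OF inj])
  have "{x. \<forall>k. x $ k \<in> A k} = (\<Inter>k. {x \<in> space borel. x $ k \<in> A k})"
    by auto
  also have "\<dots> \<in> sets borel"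
    by (intro sets.finite_INT) measurable
  finally have S [measurable]: "{x. \<forall>k. x $ k \<in> A k} \<in> sets borel" .
  have "emeasure (product_measure g) {x. \<forall>k. x $ k \<in> A k}
      = (\<integral>\<^sup>+x. ennreal (product_density g x) * indicator {x. \<forall>k. x $ k \<in> A k} x \<partial>lborel)"
    unfolding product_measure_def by (subst emeasure_density) auto
  also have "\<dots> = (\<integral>\<^sup>+x. (\<Prod>k\<in>UNIV. ?F k (x $ k)) \<partial>lborel)"
  proof (intro nn_integral_cong)
    fix x :: "real ^ 'm"
    have "indicator {x. \<forall>k. x $ k \<in> A k} x = (\<Prod>k\<in>UNIV. indicator (A k) (x $ k) :: ennreal)"
      by (auto simp: indicator_def prod_zero)
    then show "ennreal (product_density g x) * indicator {x. \<forall>k. x $ k \<in> A k} x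
        = (\<Prod>k\<in>UNIV. ?F k (x $ k))"
      using nn by (simp add: product_density_def prod.distrib prod_ennreal)
  qed
  also have "\<dots> = (\<integral>\<^sup>+x. (\<Prod>b\<in>Basis. ?F (idx b) (x \<bullet> b)) \<partial>lborel)"
    unfolding Basis by (subst prod.reindex[OF inj]) (simp add: idx inner_axis)
  also have "\<dots> = (\<Prod>b\<in>Basis. (\<integral>\<^sup>+t. ?F (idx b) t \<partial>lborel))"
    by (rule nn_integral_lborel_prod) auto
  also have "\<dots> = (\<Prod>k\<in>UNIV. (\<integral>\<^sup>+t. ?F k t \<partial>lborel))"
    unfolding Basis by (subst prod.reindex[OF inj]) (simp add: idx)
  also have "\<dots> = (\<Prod>k\<in>UNIV. emeasure (density lborel (\<lambda>t. ennreal (g k t))) (A k))"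
    by (intro prod.cong refl emeasure_density[symmetric]) auto
  finally show ?thesis .
qed

lemma prob_space_product_measure:
  assumes g: "\<And>k. prob_density (g k)"
  shows "prob_space (product_measure g)"
proof (rule prob_spaceI)
  have "emeasure (density lborel (\<lambda>t. ennreal (g k t))) UNIV = 1" for k
    using prob_space.emeasure_space_1[of "density lborel (\<lambda>t. ennreal (g k t))"]
      real_distribution_prob_density[OF g[of k]] by (simp add: real_distribution_def)
  then show "emeasure (product_measure g) (space (product_measure g)) = 1"
    using emeasure_product_measure_box[OF g, of "\<lambda>k. UNIV"] by simp
qed

lemma measure_stratum:
  fixes g :: "'m::finite \<Rightarrow> real \<Rightarrow> real"
  assumes g: "\<And>k. prob_density (g k)" and i: "i \<in> strata_index I"
  shows "measure (product_measure g) (stratum g I i) = (1 / real I) ^ CARD('m)"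
proof -
  let ?A = "\<lambda>k. {x. quantile (g k) ((real (i k) - 1) / real I) < ereal x \<and>
      ereal x \<le> quantile (g k) (real (i k) / real I)}"
  have A: "?A k \<in> sets borel" for k
    by measurable
  have "emeasure (density lborel (\<lambda>t. ennreal (g k t))) (?A k) = ennreal (1 / real I)" for k
  proof -
    interpret real_distribution "density lborel (\<lambda>t. ennreal (g k t))"
      using g by (rule real_distribution_prob_density)
    have "i k \<in> {1..I}"
      using i by (auto simp: strata_index_def PiE_iff)
    then show ?thesis
      unfolding emeasure_eq_measure using measure_quantile_interval[OF g] by simp
  qed
  then have "emeasure (product_measure g) {x. \<forall>k. x $ k \<in> ?A k} = ennreal ((1 / real I) ^ CARD('m))"
    using emeasure_product_measure_box[of g, OF g A] by (simp only: prod_constant) (rule ennreal_power, simp)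
  moreover have "{x. \<forall>k. x $ k \<in> ?A k} = stratum g I i"
    by (auto simp: stratum_def)
  ultimately show ?thesis
    by (simp add: measure_def)
qed

lemma disjoint_strata: "disjoint_family_on (stratum g I) (strata_index I)"
  unfolding disjoint_family_on_def
proof (intro ballI impI equals0I)
  fix i j x
  assume ij: "i \<in> strata_index I" "j \<in> strata_index I" "i \<noteq> j"
    and x: "x \<in> stratum g I i \<inter> stratum g I j"
  have "i k = j k" for k
    using x by (intro quantile_intervals_disjoint[of "g k" _ I "x $ k"]) (auto simp: stratum_def)
  then show False
    using ij by auto
qed

lemma partition_sequence_strata:
  fixes g :: "'m::finite \<Rightarrow> real \<Rightarrow> real"
  assumes g: "\<And>k. prob_density (g k)"
  shows "partition_sequence (product_measure g) strata_index (stratum g)"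
proof -
  interpret prob_space "product_measure g"
    using g by (rule prob_space_product_measure)
  show ?thesis
  proof
    show "0 < measure (product_measure g) (stratum g I i)" if "i \<in> strata_index I" for I i
    proof -
      \<comment> \<open>For \<open>I = 0\<close> the index set is empty, so the existence of an
        index makes \<open>I\<close> positive.\<close>
      have "I \<noteq> 0"
        using that by (auto simp: strata_index_def PiE_iff)
      then show ?thesis
        using measure_stratum[OF g that] by simp
    qed
  qed (auto simp: disjoint_strata)
qed

text \<open>A stratum cut by no hyperplane \<open>x $ k = a $ k\<close> lies inside or outside the
  orthant, and the indicator is constant on it. For each coordinate at most
  \<open>I ^ (CARD('m) - 1)\<close> strata are cut, and each contributes at most its mass
  \<open>(1 / I) ^ CARD('m)\<close>.\<close>

lemma osc_box_strata:
  fixes g :: "'m::finite \<Rightarrow> real \<Rightarrow> real" and a :: "real ^ 'm"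
  assumes g: "\<And>k. prob_density (g k)" and I: "0 < I"
  shows "partition_sequence.osc (product_measure g) strata_index (stratum g) I (indicator {..a})
    \<le> real CARD('m) / real I"
proof -
  let ?N = "product_measure g"
  interpret partition_sequence ?N strata_index "stratum g"
    using g by (rule partition_sequence_strata)
  let ?f = "\<lambda>i. LINT x:stratum g I i|?N. \<bar>indicator {..a} x - avg I (indicator {..a}) i\<bar>"
  let ?bad = "\<Union>k. {i \<in> strata_index I. quantile (g k) ((real (i k) - 1) / real I) < ereal (a $ k) \<and>
      ereal (a $ k) \<le> quantile (g k) (real (i k) / real I)}"
  have good: "?f i = 0" if i: "i \<in> strata_index I - ?bad" for i
  proof -
    \<comment> \<open>If the stratum has \<open>y\<close> in the orthant and \<open>x\<close>
      outside, some coordinate satisfies \<open>y $ k \<le> a $ k < x $ k\<close>. Then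
      \<open>a $ k\<close> lies in side \<open>k\<close> of the stratum, so the index belongs to
      \<open>?bad\<close>.\<close>
    have "stratum g I i \<subseteq> {..a} \<or> stratum g I i \<inter> {..a} = {}"
    proof (rule ccontr)
      assume "\<not> ?thesis"
      then obtain x y where xy: "x \<in> stratum g I i" "\<not> x \<le> a" "y \<in> stratum g I i" "y \<le> a"
        by auto
      then obtain k where k: "a $ k < x $ k" "y $ k \<le> a $ k"
        by (auto simp: less_eq_vec_def not_le)
      have "quantile (g k) ((real (i k) - 1) / real I) < ereal (a $ k)"
        using xy(3) k(2) unfolding stratum_def by (auto intro: less_le_trans)
      moreover have "ereal (a $ k) \<le> quantile (g k) (real (i k) / real I)"
        using xy(1) k(1) unfolding stratum_def
        by (auto intro: order_trans[of _ "ereal (x $ k)"])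
      ultimately show False
        using i by auto
    qed
    then have "(\<forall>x\<in>stratum g I i. indicat_real {..a} x = 1) \<or>
        (\<forall>x\<in>stratum g I i. indicat_real {..a} x = 0)"
      by (auto simp: indicator_def)
    then obtain c where c: "\<And>x. x \<in> stratum g I i \<Longrightarrow> indicat_real {..a} x = c"
      by blast
    have "(LINT x:stratum g I i|?N. indicat_real {..a} x) = c * prob (stratum g I i)"
      using i c set_lebesgue_integral_cong[of "stratum g I i" ?N "indicat_real {..a}" "\<lambda>x. c"]
      by (simp add: set_integral_const_cell)
    then have "avg I (indicator {..a}) i = c"
      using cell_pos[of i I] i by (simp add: avg_def)
    then have "?f i = (LINT x:stratum g I i|?N. 0)"
      using c by (intro set_lebesgue_integral_cong) auto
    then show ?thesis
      by simp
  qed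
  have le: "?f i \<le> (1 / real I) ^ CARD('m)" if i: "i \<in> strata_index I" for i
  proof -
    have int: "integrable ?N (indicat_real {..a})"
      by (intro integrable_real_indicator) (auto simp: emeasure_eq_measure)
    have "0 \<le> (LINT x:stratum g I i|?N. indicat_real {..a} x)"
      unfolding set_lebesgue_integral_def by (intro Bochner_Integration.integral_nonneg) auto
    moreover have "(LINT x:stratum g I i|?N. indicat_real {..a} x) \<le> (LINT x:stratum g I i|?N. 1)"
      using i int by (intro set_integral_mono set_integrable_cell) auto
    ultimately have "0 \<le> avg I (indicator {..a}) i" "avg I (indicator {..a}) i \<le> 1"
      using cell_pos[OF i] set_integral_const_cell[OF i, of 1] by (simp_all add: avg_def)
    then have "\<bar>indicat_real {..a} x - avg I (indicator {..a}) i\<bar> \<le> 1" for x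
      by (auto simp: indicator_def)
    then have "?f i \<le> (LINT x:stratum g I i|?N. 1)"
      by (intro set_integral_mono set_integrable_osc[OF int i] set_integrable_cell[OF _ i]) auto
    then show ?thesis
      using i set_integral_const_cell[OF i, of 1] measure_stratum[OF g i] by simp
  qed
  have card_bad: "card ?bad \<le> CARD('m) * I ^ (CARD('m) - 1)"
  proof -
    have "card ?bad \<le> (\<Sum>k\<in>UNIV. card {i \<in> strata_index I.
        quantile (g k) ((real (i k) - 1) / real I) < ereal (a $ k) \<and>
        ereal (a $ k) \<le> quantile (g k) (real (i k) / real I)})"
      by (rule card_UN_le) simp
    also have "\<dots> \<le> (\<Sum>k\<in>(UNIV :: 'm set). I ^ (CARD('m) - 1))"
    proof (rule sum_mono)
      fix k
      let ?K = "{i \<in> strata_index I :: ('m \<Rightarrow> nat) set.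
        quantile (g k) ((real (i k) - 1) / real I) < ereal (a $ k) \<and>
        ereal (a $ k) \<le> quantile (g k) (real (i k) / real I)}"
      \<comment> \<open>Sides with different indices are disjoint, so \<open>a $ k\<close>
        determines \<open>i k\<close>; if \<open>?K\<close> is empty any \<open>c\<close>
        serves.\<close>
      have "\<exists>c. ?K \<subseteq> {i \<in> strata_index I. i k = c}"
        using quantile_intervals_disjoint[of "g k" _ I "a $ k"] by blast
      then obtain c where "?K \<subseteq> {i \<in> strata_index I. i k = c}"
        by blast
      then have "card ?K \<le> card {i \<in> strata_index I :: ('m \<Rightarrow> nat) set. i k = c}"
        by (intro card_mono) auto
      also have "\<dots> \<le> I ^ (CARD('m) - 1)"
        by (rule card_strata_index_fixed)
      finally show "card ?K \<le> I ^ (CARD('m) - 1)" .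
    qed
    finally show ?thesis
      by simp
  qed
  have "osc I (indicator {..a}) = (\<Sum>i\<in>?bad. ?f i)"
    unfolding osc_def using good by (intro sum.mono_neutral_right) auto
  also have "\<dots> \<le> real (card ?bad) * (1 / real I) ^ CARD('m)"
    using le by (intro sum_bounded_above) auto
  also have "\<dots> \<le> real (CARD('m) * I ^ (CARD('m) - 1)) * (1 / real I) ^ CARD('m)"
    using card_bad by (intro mult_right_mono) (simp_all only: of_nat_le_iff, simp)
  also have "\<dots> = real CARD('m) / real I"
  proof -
    have "(1 / real I) ^ CARD('m) = (1 / real I) ^ (CARD('m) - 1) * (1 / real I)"
      using power_minus_mult[of "CARD('m)" "1 / real I"] by simp
    then show ?thesis
      using I by (simp add: power_divide)
  qed
  finally show ?thesis .
qed

text \<open>The Dynkin argument runs on lower orthants: they generate the Borel sets, and two of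
  them intersect in the orthant of the coordinatewise infimum.\<close>

lemma osc_strata_tendsto_0:
  fixes g :: "'m::finite \<Rightarrow> real \<Rightarrow> real"
  assumes g: "\<And>k. prob_density (g k)" and F: "integrable (product_measure g) F"
  shows "(\<lambda>I. partition_sequence.osc (product_measure g) strata_index (stratum g) I F) \<longlonglongrightarrow> 0"
proof -
  let ?N = "product_measure g"
  interpret partition_sequence ?N strata_index "stratum g"
    using g by (rule partition_sequence_strata)
  show ?thesis
  proof (rule osc_tendsto_0[OF _ _ _ _ F])
    show "Int_stable (range (\<lambda>a. {..a :: real ^ 'm}))"
    proof (rule Int_stableI)
      fix A B :: "(real ^ 'm) set"
      assume "A \<in> range atMost" "B \<in> range atMost"
      then obtain a b where "A = {..a}" "B = {..b}"
        by auto
      then have "A \<inter> B = {..inf a b}"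
        by auto
      then show "A \<inter> B \<in> range atMost"
        by simp
    qed
    show "sets ?N = sigma_sets (space ?N) (range atMost)"
      by (simp add: borel_eq_atMost)
  next
    fix B :: "(real ^ 'm) set"
    assume "B \<in> range atMost"
    then obtain a where B: "B = {..a}"
      by auto
    have lim: "(\<lambda>I. real CARD('m) / real I) \<longlonglongrightarrow> 0"
      by (rule lim_const_over_n)
    show "(\<lambda>I. osc I (indicator B)) \<longlonglongrightarrow> 0"
      unfolding B
    proof (rule tendsto_sandwich[OF _ _ tendsto_const lim])
      show "\<forall>\<^sub>F I in sequentially. osc I (indicator {..a}) \<le> real CARD('m) / real I"
        using osc_box_strata[of g, OF g] by (intro eventually_sequentiallyI[of 1]) simp
    qed (simp add: osc_nonneg)
  qed simp
qed

text \<open>The disjoint strata are counted by mass: \<open>I ^ CARD('m)\<close> of them, each of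
  mass \<open>(1 / I) ^ CARD('m)\<close>. Exact covering can fail, since points with a coordinate at
  or below the lowest quantile, or above the highest, lie in no stratum.\<close>

lemma AE_stratum_cover:
  fixes g :: "'m::finite \<Rightarrow> real \<Rightarrow> real"
  assumes g: "\<And>k. prob_density (g k)" and I: "0 < I"
  shows "AE x in product_measure g. x \<in> (\<Union>i\<in>strata_index I. stratum g I i)"
proof -
  let ?N = "product_measure g"
  interpret partition_sequence ?N strata_index "stratum g"
    using g by (rule partition_sequence_strata)
  have "prob (\<Union>i\<in>strata_index I. stratum g I i) = (\<Sum>i\<in>strata_index I. prob (stratum g I i))"
    by (intro finite_measure_finite_Union disjoint_strata) auto
  also have "\<dots> = 1"
    using I by (simp add: measure_stratum[OF g] card_strata_index power_divide)
  finally show ?thesis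
    by (intro AE_prob_1) auto
qed

subsection \<open>Conditional variances and conditional expectations\<close>

text \<open>The squared probability clears the denominators of the conditional moments, so the
  identity persists on null events, where both sides vanish.\<close>

lemma uniform_measure_variance:
  assumes P: "prob_space P" and E: "E \<in> sets P"
    and W: "integrable P W" "integrable P (\<lambda>\<omega>. (W \<omega>)\<^sup>2)"
  shows "(measure P E)\<^sup>2 * prob_space.variance (uniform_measure P E) W
    = measure P E * (LINT \<omega>:E|P. (W \<omega>)\<^sup>2) - (LINT \<omega>:E|P. W \<omega>)\<^sup>2"
proof -
  interpret prob_space P by (rule P)
  note [measurable] = E borel_measurable_integrable[OF W(1)]
  show ?thesis
  proof (cases "prob E = 0")
    case True
    then have "AE \<omega> in P. \<omega> \<notin> E"
      using E prob_eq_0[of E] by simp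
    then have "(LINT \<omega>:E|P. W \<omega>) = 0"
      unfolding set_lebesgue_integral_def by (intro integral_eq_zero_AE) auto
    then show ?thesis
      using True by simp
  next
    case False
    then have p: "0 < prob E"
      using measure_nonneg[of P E] by linarith
    \<comment> \<open>For positive probability the conditional law has a real-valued density, so its
      integrals become integrals over \<open>E\<close> divided by \<open>prob E\<close>.\<close>
    have U: "uniform_measure P E = density P (\<lambda>\<omega>. ennreal (indicator E \<omega> / prob E))"
      unfolding uniform_measure_def using p
      by (intro density_cong AE_I2)
        (auto simp: emeasure_eq_measure indicator_def divide_ennreal ennreal_1[symmetric] simp del: ennreal_1)
    have int: "(\<integral>\<omega>. V \<omega> \<partial>uniform_measure P E) = (LINT \<omega>:E|P. V \<omega>) / prob E"
      if "V \<in> borel_measurable P" for V :: "_ \<Rightarrow> real"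
      unfolding U set_lebesgue_integral_def using that
      by (subst integral_density) auto
    define m where "m = (\<integral>\<omega>. W \<omega> \<partial>uniform_measure P E)"
    have m: "m = (LINT \<omega>:E|P. W \<omega>) / prob E"
      unfolding m_def by (intro int) measurable
    have sint: "set_integrable P E V" if "integrable P V" for V :: "_ \<Rightarrow> real"
      using that E unfolding set_integrable_def by (intro integrable_mult_indicator)
    have "(LINT \<omega>:E|P. (W \<omega> - m)\<^sup>2) = (LINT \<omega>:E|P. ((W \<omega>)\<^sup>2 - 2 * m * W \<omega>) + m\<^sup>2)"
      by (simp add: power2_diff algebra_simps)
    also have "\<dots> = (LINT \<omega>:E|P. (W \<omega>)\<^sup>2) - 2 * m * (LINT \<omega>:E|P. W \<omega>) + m\<^sup>2 * prob E"
    proof -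
      have "(LINT \<omega>:E|P. m\<^sup>2) = m\<^sup>2 * prob E"
        unfolding set_lebesgue_integral_def by simp
      then show ?thesis
        using W by (subst set_integral_add, (auto intro!: sint)[2])
          (subst set_integral_diff, auto intro!: sint)
    qed
    finally have "(LINT \<omega>:E|P. (W \<omega> - m)\<^sup>2)
        = (LINT \<omega>:E|P. (W \<omega>)\<^sup>2) - 2 * m * (LINT \<omega>:E|P. W \<omega>) + m\<^sup>2 * prob E" .
    moreover have "(\<integral>\<omega>. (W \<omega> - m)\<^sup>2 \<partial>uniform_measure P E) = (LINT \<omega>:E|P. (W \<omega> - m)\<^sup>2) / prob E"
      by (intro int) measurable
    ultimately show ?thesis
      unfolding m_def[symmetric] using p
      by (simp add: m field_simps power2_eq_square)
  qed
qed

lemma subalgebra_vimage_algebra: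
  assumes "X \<in> measurable M N"
  shows "subalgebra M (vimage_algebra (space M) X N)"
  unfolding subalgebra_def using assms by (auto intro: sets_image_in_sets[THEN subsetD])

text \<open>The event that \<open>X\<close> lies in \<open>S\<close> belongs to the sigma-algebra
  generated by \<open>X\<close>. There \<open>Z\<close> may be replaced by \<open>h\<close> composed
  with \<open>X\<close>, and the density \<open>f\<close> moves the integral to Lebesgue measure.
  Integrability is inherited from the conditional expectation.\<close>

lemma
  fixes X :: "'a \<Rightarrow> 'b::euclidean_space"
  assumes P: "prob_space P" and f: "\<And>x. 0 \<le> f x"
    and D: "distributed P lborel X (\<lambda>x. ennreal (f x))"
    and Z: "integrable P Z" and h: "cond_exp_given P Z X h"
  shows cond_exp_given_integrable: "integrable lborel (\<lambda>x. f x * h x)"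
    and cond_exp_given_set_integral:
      "S \<in> sets borel \<Longrightarrow> (LINT \<omega>:{\<omega> \<in> space P. X \<omega> \<in> S}|P. Z \<omega>) = (LINT x:S|lborel. f x * h x)"
proof -
  interpret prob_space P by (rule P)
  have X [measurable]: "X \<in> measurable P borel"
    using distributed_measurable[OF D] by simp
  have f_meas [measurable]: "f \<in> borel_measurable borel"
    using distributed_real_measurable[OF _ D] f by simp
  have h_meas [measurable]: "h \<in> borel_measurable borel"
    and ce: "AE \<omega> in P. real_cond_exp P (vimage_algebra (space P) X borel) Z \<omega> = h (X \<omega>)"
    using h by (auto simp: cond_exp_given_def)
  let ?F = "vimage_algebra (space P) X borel"
  interpret finite_measure_subalgebra P ?F
    by unfold_locales (rule subalgebra_vimage_algebra[OF X])
  have "integrable P (\<lambda>\<omega>. h (X \<omega>)) \<longleftrightarrow> integrable P (real_cond_exp P ?F Z)"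
    using ce by (intro integrable_cong_AE) auto
  then have "integrable (distr P lborel X) h"
    using real_cond_exp_int(1)[OF Z] by (subst integrable_distr_eq) auto
  then show int: "integrable lborel (\<lambda>x. f x * h x)"
    unfolding distributed_distr_eq_density[OF D] using f by (subst (asm) integrable_density) auto
  assume S [measurable]: "S \<in> sets borel"
  have "{\<omega> \<in> space P. X \<omega> \<in> S} \<in> sets ?F"
    using in_vimage_algebra[OF S, of X "space P"] by (simp add: vimage_def Int_def conj_commute)
  then have "(LINT \<omega>:{\<omega> \<in> space P. X \<omega> \<in> S}|P. Z \<omega>)
      = (LINT \<omega>:{\<omega> \<in> space P. X \<omega> \<in> S}|P. real_cond_exp P ?F Z \<omega>)"
    by (rule real_cond_exp_intA[OF Z])
  also have "\<dots> = (\<integral>\<omega>. indicator S (X \<omega>) * h (X \<omega>) \<partial>P)"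
    unfolding set_lebesgue_integral_def
    using ce by (intro integral_cong_AE) (auto simp: indicator_def)
  also have "\<dots> = (\<integral>x. f x * (indicator S x * h x) \<partial>lborel)"
    using f by (intro distributed_integral[OF D, symmetric]) auto
  also have "\<dots> = (LINT x:S|lborel. f x * h x)"
    unfolding set_lebesgue_integral_def by (simp add: mult_ac)
  finally show "(LINT \<omega>:{\<omega> \<in> space P. X \<omega> \<in> S}|P. Z \<omega>) = (LINT x:S|lborel. f x * h x)" .
qed

text \<open>Conditional Jensen for the square, transported to the law of \<open>X\<close>, which
  sees only points with \<open>0 < f x\<close>. The inequality later keeps \<open>ennreal\<close>
  from truncating negative values in the asymptotic variance.\<close>

lemma cond_exp_given_power2_le:
  fixes X :: "'a \<Rightarrow> 'b::euclidean_space"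
  assumes P: "prob_space P" and f: "\<And>x. 0 \<le> f x"
    and D: "distributed P lborel X (\<lambda>x. ennreal (f x))"
    and Z: "integrable P Z" "integrable P (\<lambda>\<omega>. (Z \<omega>)\<^sup>2)"
    and h: "cond_exp_given P Z X h" "cond_exp_given P (\<lambda>\<omega>. (Z \<omega>)\<^sup>2) X k"
  shows "AE x in lborel. 0 < f x \<longrightarrow> (h x)\<^sup>2 \<le> k x"
proof -
  interpret prob_space P by (rule P)
  have X [measurable]: "X \<in> measurable P borel"
    using distributed_measurable[OF D] by simp
  have f_meas [measurable]: "f \<in> borel_measurable borel"
    using distributed_real_measurable[OF _ D] f by simp
  have [measurable]: "h \<in> borel_measurable borel" "k \<in> borel_measurable borel"
    using h by (auto simp: cond_exp_given_def)
  let ?F = "vimage_algebra (space P) X borel"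
  interpret finite_measure_subalgebra P ?F
    by unfold_locales (rule subalgebra_vimage_algebra[OF X])
  have "AE \<omega> in P. (real_cond_exp P ?F Z \<omega>)\<^sup>2 \<le> real_cond_exp P ?F (\<lambda>\<omega>. (Z \<omega>)\<^sup>2) \<omega>"
    using Z by (intro real_cond_exp_jensens_inequality(2)[of Z UNIV 0 0 "\<lambda>x. x\<^sup>2"])
      (auto intro: convex_power2)
  moreover have "AE \<omega> in P. real_cond_exp P ?F Z \<omega> = h (X \<omega>)"
    "AE \<omega> in P. real_cond_exp P ?F (\<lambda>\<omega>. (Z \<omega>)\<^sup>2) \<omega> = k (X \<omega>)"
    using h by (auto simp: cond_exp_given_def)
  ultimately have "AE \<omega> in P. (h (X \<omega>))\<^sup>2 \<le> k (X \<omega>)"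
    by eventually_elim simp
  then have "AE x in distr P lborel X. (h x)\<^sup>2 \<le> k x"
    by (subst AE_distr_iff) auto
  then show ?thesis
    unfolding distributed_distr_eq_density[OF D] by (subst (asm) AE_density) auto
qed

text \<open>Integrating against \<open>product_measure g\<close> undoes the division by its density.
  Where that density is 0 the quotient is 0 by the convention for real division, which matches
  \<open>h\<close> because \<open>h\<close> vanishes there.\<close>

lemma
  fixes h :: "real ^ 'm::finite \<Rightarrow> real"
  assumes g: "\<And>k. prob_density (g k)" and [measurable]: "h \<in> borel_measurable borel"
    and h0: "AE x in lborel. product_density g x = 0 \<longrightarrow> h x = 0"
  shows integrable_product_measure_quotient:
      "integrable (product_measure g) (\<lambda>x. h x / product_density g x) \<longleftrightarrow> integrable lborel h"
    and set_integral_product_measure_quotient: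
      "S \<in> sets borel \<Longrightarrow>
        (LINT x:S|product_measure g. h x / product_density g x) = (LINT x:S|lborel. h x)"
proof -
  note [measurable] = measurable_product_density[OF g]
  have eq: "AE x in lborel. product_density g x * (h x / product_density g x) = h x"
    using h0 by eventually_elim auto
  have "integrable (product_measure g) (\<lambda>x. h x / product_density g x)
      \<longleftrightarrow> integrable lborel (\<lambda>x. product_density g x * (h x / product_density g x))"
    unfolding product_measure_def using product_density_nonneg[of g, OF g]
    by (subst integrable_density) auto
  also have "\<dots> \<longleftrightarrow> integrable lborel h"
    using eq by (intro integrable_cong_AE) auto
  finally show "integrable (product_measure g) (\<lambda>x. h x / product_density g x)
      \<longleftrightarrow> integrable lborel h" .
  assume [measurable]: "S \<in> sets borel"
  have "(LINT x:S|product_measure g. h x / product_density g x)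
      = (\<integral>x. product_density g x *\<^sub>R (indicator S x *\<^sub>R (h x / product_density g x)) \<partial>lborel)"
    unfolding product_measure_def set_lebesgue_integral_def using product_density_nonneg[of g, OF g]
    by (intro integral_density) auto
  also have "\<dots> = (LINT x:S|lborel. h x)"
    unfolding set_lebesgue_integral_def
  proof (rule integral_cong_AE)
    show "AE x in lborel. product_density g x *\<^sub>R (indicator S x *\<^sub>R (h x / product_density g x))
        = indicator S x *\<^sub>R h x"
      using h0 by eventually_elim (auto simp: indicator_def)
  qed auto
  finally show "(LINT x:S|product_measure g. h x / product_density g x) = (LINT x:S|lborel. h x)" .
qed

text \<open>A point with \<open>p x = 0\<close> and \<open>f x \<noteq> 0\<close> makes the quotient
  infinite in \<open>ennreal\<close>; a finite integral allows this only on a null set.\<close>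

lemma AE_zero_of_quotient_integral_finite:
  assumes [measurable]: "f \<in> borel_measurable M" "p \<in> borel_measurable M"
    and p: "\<And>x. 0 \<le> p x"
    and fin: "(\<integral>\<^sup>+ x. ennreal ((f x)\<^sup>2) / ennreal (p x) \<partial>M) < \<infinity>"
  shows "AE x in M. p x = 0 \<longrightarrow> f x = 0"
proof -
  have "AE x in M. ennreal ((f x)\<^sup>2) / ennreal (p x) \<noteq> \<infinity>"
    using fin by (intro nn_integral_noteq_infinite) auto
  then show ?thesis
  proof eventually_elim
    case (elim x)
    then show ?case
      by (auto simp: ennreal_divide_eq_top_iff)
  qed
qed

subsection \<open>Optimal allocation\<close>

text \<open>Reflexivity puts \<open>i\<close> itself into the first partial sum, so the two sums
  differ by \<open>q i\<close>, and a difference of floors is within 1 of the difference of the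
  arguments.\<close>

lemma num_draws_rounding:
  fixes q :: "('m::finite \<Rightarrow> nat) \<Rightarrow> real"
  assumes r: "linear_order_on (strata_index I) r" and i: "i \<in> strata_index I"
  shows "\<bar>real_of_int (num_draws r I M q i) - real M * q i\<bar> < 1"
proof -
  let ?L = "{j \<in> strata_index I. (j, i) \<in> r \<and> j \<noteq> i}"
  have "(i, i) \<in> r"
    using r i by (auto simp: linear_order_on_def partial_order_on_def preorder_on_def refl_on_def)
  then have "{j \<in> strata_index I. (j, i) \<in> r} = insert i ?L"
    using i by auto
  then have "(\<Sum>j\<in>{j \<in> strata_index I. (j, i) \<in> r}. q j) = q i + (\<Sum>j\<in>?L. q j)"
    by simp
  then show ?thesis
    unfolding num_draws_def by (simp add: distrib_left) linarith
qed

text \<open>With \<open>A\<close> the total of the \<open>a\<close>, write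
  \<open>a / A - b / C = (a - b) / C + a * (1 / A - 1 / C)\<close>. The second part sums to
  \<open>\<bar>1 - A / C\<bar>\<close> in absolute value, which vanishes in the limit.\<close>

lemma normalized_l1_distance_tendsto_0:
  fixes a b :: "nat \<Rightarrow> 'i \<Rightarrow> real"
  assumes C: "0 < C" and a: "\<And>n i. 0 \<le> a n i"
    and dist: "(\<lambda>n. \<Sum>i\<in>J n. \<bar>a n i - b n i\<bar>) \<longlonglongrightarrow> 0"
    and total: "(\<lambda>n. \<Sum>i\<in>J n. a n i) \<longlonglongrightarrow> C"
  shows "(\<lambda>n. \<Sum>i\<in>J n. \<bar>a n i / (\<Sum>j\<in>J n. a n j) - b n i / C\<bar>) \<longlonglongrightarrow> 0"
proof -
  let ?A = "\<lambda>n. \<Sum>i\<in>J n. a n i"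
  have lim: "(\<lambda>n. (\<Sum>i\<in>J n. \<bar>a n i - b n i\<bar>) / C + \<bar>1 - ?A n / C\<bar>) \<longlonglongrightarrow> 0"
    by (rule tendsto_eq_intros dist total | use C in force)+
  show ?thesis
  proof (rule tendsto_sandwich[OF _ _ tendsto_const lim])
    have "\<forall>\<^sub>F n in sequentially. 0 < ?A n"
      using total C by (rule order_tendstoD(1))
    then show "\<forall>\<^sub>F n in sequentially. (\<Sum>i\<in>J n. \<bar>a n i / ?A n - b n i / C\<bar>)
        \<le> (\<Sum>i\<in>J n. \<bar>a n i - b n i\<bar>) / C + \<bar>1 - ?A n / C\<bar>"
    proof eventually_elim
      case (elim n)
      have "\<bar>a n i / ?A n - b n i / C\<bar> \<le> \<bar>a n i - b n i\<bar> / C + a n i * \<bar>1 / ?A n - 1 / C\<bar>" for i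
      proof -
        have "a n i / ?A n - b n i / C = (a n i - b n i) / C + a n i * (1 / ?A n - 1 / C)"
          by (simp add: diff_divide_distrib right_diff_distrib)
        also have "\<bar>\<dots>\<bar> \<le> \<bar>(a n i - b n i) / C\<bar> + \<bar>a n i * (1 / ?A n - 1 / C)\<bar>"
          by (rule abs_triangle_ineq)
        finally show ?thesis
          using C a[of n i] by (simp add: abs_mult)
      qed
      then have "(\<Sum>i\<in>J n. \<bar>a n i / ?A n - b n i / C\<bar>)
          \<le> (\<Sum>i\<in>J n. \<bar>a n i - b n i\<bar> / C + a n i * \<bar>1 / ?A n - 1 / C\<bar>)"
        by (rule sum_mono)
      also have "\<dots> = (\<Sum>i\<in>J n. \<bar>a n i - b n i\<bar>) / C + ?A n * \<bar>1 / ?A n - 1 / C\<bar>"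
        by (simp add: sum.distrib sum_divide_distrib sum_distrib_right)
      also have "?A n * \<bar>1 / ?A n - 1 / C\<bar> = \<bar>?A n * (1 / ?A n - 1 / C)\<bar>"
        using elim by (simp add: abs_mult)
      also have "?A n * (1 / ?A n - 1 / C) = 1 - ?A n / C"
        using elim by (simp add: right_diff_distrib)
      finally show ?case .
    qed
  qed (simp add: sum_nonneg)
qed

text \<open>The product is the root of squared mass times variance, a discriminant of moments over
  the stratum event; the density and the conditional expectations turn these moments into Lebesgue
  integrals.\<close>

lemma stratum_prob_times_sd:
  fixes P :: "'a measure" and Y :: "'a \<Rightarrow> real ^ 'd" and \<phi> :: "real ^ 'd \<Rightarrow> real"
    and g :: "'m::finite \<Rightarrow> real \<Rightarrow> real" and \<mu> :: "real ^ 'm ^ 'd"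
  assumes P: "prob_space P"
    and W: "integrable P (\<lambda>\<omega>. \<phi> (Y \<omega>))" "integrable P (\<lambda>\<omega>. (\<phi> (Y \<omega>))\<^sup>2)"
    and f: "\<And>x. 0 \<le> f x"
    and D: "distributed P lborel (\<lambda>\<omega>. transpose \<mu> *v Y \<omega>) (\<lambda>x. ennreal (f x))"
    and \<psi>: "cond_exp_given P (\<lambda>\<omega>. \<phi> (Y \<omega>)) (\<lambda>\<omega>. transpose \<mu> *v Y \<omega>) \<psi>"
    and \<zeta>: "cond_exp_given P (\<lambda>\<omega>. (\<phi> (Y \<omega>))\<^sup>2) (\<lambda>\<omega>. transpose \<mu> *v Y \<omega>) \<zeta>"
  shows "stratum_prob P Y \<mu> g I i * stratum_sd P Y \<phi> \<mu> g I i
    = sqrt ((LINT x:stratum g I i|lborel. f x) * (LINT x:stratum g I i|lborel. f x * \<zeta> x)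
        - (LINT x:stratum g I i|lborel. f x * \<psi> x)\<^sup>2)"
proof -
  interpret prob_space P by (rule P)
  let ?X = "\<lambda>\<omega>. transpose \<mu> *v Y \<omega>" and ?S = "stratum g I i"
  let ?E = "stratum_event P Y \<mu> g I i"
  have X [measurable]: "?X \<in> measurable P borel"
    using distributed_measurable[OF D] by simp
  have E_eq: "?E = {\<omega> \<in> space P. ?X \<omega> \<in> ?S}"
    by (simp add: stratum_event_def)
  have "{\<omega> \<in> space P. ?X \<omega> \<in> ?S} \<in> sets P"
    by measurable
  then have E: "?E \<in> sets P"
    by (simp only: E_eq)
  have "prob ?E = (\<integral>\<omega>. indicator ?S (?X \<omega>) \<partial>P)"
  proof -
    have "prob ?E = (\<integral>\<omega>. indicat_real ?E \<omega> \<partial>P)"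
      using E by simp
    also have "\<dots> = (\<integral>\<omega>. indicator ?S (?X \<omega>) \<partial>P)"
      unfolding E_eq by (intro Bochner_Integration.integral_cong) (auto simp: indicator_def)
    finally show ?thesis .
  qed
  also have "\<dots> = (\<integral>x. f x * indicator ?S x \<partial>lborel)"
    using f by (intro distributed_integral[OF D, symmetric]) auto
  finally have p: "prob ?E = (LINT x:?S|lborel. f x)"
    unfolding set_lebesgue_integral_def by (simp add: mult.commute)
  have "(prob ?E)\<^sup>2 * stratum_var P Y \<phi> \<mu> g I i
      = prob ?E * (LINT \<omega>:?E|P. (\<phi> (Y \<omega>))\<^sup>2) - (LINT \<omega>:?E|P. \<phi> (Y \<omega>))\<^sup>2"
    unfolding stratum_var_def by (rule uniform_measure_variance[OF P E W])
  also have "(LINT \<omega>:?E|P. (\<phi> (Y \<omega>))\<^sup>2) = (LINT x:?S|lborel. f x * \<zeta> x)"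
    unfolding E_eq by (rule cond_exp_given_set_integral[OF P f D W(2) \<zeta>]) simp
  also have "(LINT \<omega>:?E|P. \<phi> (Y \<omega>)) = (LINT x:?S|lborel. f x * \<psi> x)"
    unfolding E_eq by (rule cond_exp_given_set_integral[OF P f D W(1) \<psi>]) simp
  finally have eq: "(prob ?E)\<^sup>2 * stratum_var P Y \<phi> \<mu> g I i
      = (LINT x:?S|lborel. f x) * (LINT x:?S|lborel. f x * \<zeta> x) - (LINT x:?S|lborel. f x * \<psi> x)\<^sup>2"
    unfolding p .
  show ?thesis
    unfolding stratum_prob_def stratum_sd_def eq[symmetric] by (simp add: real_sqrt_mult)
qed

section \<open>Variances at the optimal density and under the optimal allocation\<close>

lemma stratum_var_nonneg: "0 \<le> stratum_var P Y \<phi> \<mu> g I i"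
  unfolding stratum_var_def by (intro Bochner_Integration.integral_nonneg) auto

text \<open>With \<open>v = \<zeta> - \<psi>^2\<close> and \<open>C\<close> the integral of
  \<open>f * sqrt v\<close>, the integrand \<open>f^2 * v / (f * sqrt v / C)\<close> collapses to
  \<open>C * f * sqrt v\<close>.\<close>

lemma asymp_variance_opt_density:
  fixes f \<zeta> \<psi> :: "real ^ 'm::finite \<Rightarrow> real"
  assumes f: "\<And>x. 0 \<le> f x"
    and int: "integrable lborel (\<lambda>x. f x * sqrt (\<zeta> x - (\<psi> x)\<^sup>2))"
    and le: "AE x in lborel. 0 < f x \<longrightarrow> (\<psi> x)\<^sup>2 \<le> \<zeta> x"
    and C: "0 < (\<integral>x. f x * sqrt (\<zeta> x - (\<psi> x)\<^sup>2) \<partial>lborel)"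
  shows "asymp_variance f \<zeta> \<psi> (opt_density f \<zeta> \<psi>)
    = ennreal ((\<integral>x. f x * sqrt (\<zeta> x - (\<psi> x)\<^sup>2) \<partial>lborel)\<^sup>2)"
proof -
  define C where "C = (\<integral>x. f x * sqrt (\<zeta> x - (\<psi> x)\<^sup>2) \<partial>lborel)"
  have C0: "0 < C"
    using C by (simp add: C_def)
  have pos: "AE x in lborel. 0 \<le> f x * sqrt (\<zeta> x - (\<psi> x)\<^sup>2)"
    using le
  proof eventually_elim
    case (elim x)
    then show ?case
      using f[of x] by (cases "f x = 0") auto
  qed
  have "asymp_variance f \<zeta> \<psi> (opt_density f \<zeta> \<psi>)
      = (\<integral>\<^sup>+ x. ennreal (C * (f x * sqrt (\<zeta> x - (\<psi> x)\<^sup>2))) \<partial>lborel)"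
    unfolding asymp_variance_def
  proof (rule nn_integral_cong_AE)
    show "AE x in lborel. ennreal ((f x)\<^sup>2 * (\<zeta> x - (\<psi> x)\<^sup>2)) / ennreal (opt_density f \<zeta> \<psi> x)
        = ennreal (C * (f x * sqrt (\<zeta> x - (\<psi> x)\<^sup>2)))"
      using le
    proof eventually_elim
      case (elim x)
      show ?case
      proof (cases "f x = 0 \<or> \<zeta> x = (\<psi> x)\<^sup>2")
        \<comment> \<open>The numerator is 0, and \<open>0 / z = 0\<close> in \<open>ennreal\<close>
          even for \<open>z = 0\<close>.\<close>
        case True
        then show ?thesis by auto
      next
        case False
        then have fx: "0 < f x" and v: "0 < \<zeta> x - (\<psi> x)\<^sup>2"
          using f[of x] elim by (auto simp: less_le)
        define s where "s = sqrt (\<zeta> x - (\<psi> x)\<^sup>2)"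
        have s: "0 < s" "\<zeta> x - (\<psi> x)\<^sup>2 = s\<^sup>2"
          using v by (simp_all add: s_def)
        have "opt_density f \<zeta> \<psi> x = f x * s / C"
          by (simp add: opt_density_def s_def C_def)
        then show ?thesis
          unfolding s_def[symmetric] s(2) using fx s(1) C0
          by (simp add: divide_ennreal power2_eq_square)
      qed
    qed
  qed
  also have "\<dots> = ennreal (\<integral>x. C * (f x * sqrt (\<zeta> x - (\<psi> x)\<^sup>2)) \<partial>lborel)"
    using int pos C0 by (intro nn_integral_eq_integral) auto
  also have "\<dots> = ennreal (C\<^sup>2)"
    by (simp add: C_def power2_eq_square)
  finally show ?thesis
    by (simp add: C_def)
qed

text \<open>Under the optimal allocation squared mass times variance is \<open>T^2\<close> times the
  squared share in every stratum. The scaled variance is thus \<open>T^2\<close> times the sum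
  controlled by \<open>rounded_allocation_variance\<close>.\<close>

lemma strat_variance_opt_alloc_bound:
  fixes P :: "'a measure" and Y :: "'a \<Rightarrow> real ^ 'd" and \<phi> :: "real ^ 'd \<Rightarrow> real"
    and g :: "'m::finite \<Rightarrow> real \<Rightarrow> real" and \<mu> :: "real ^ 'm ^ 'd" and I :: nat
  defines "T \<equiv> \<Sum>i\<in>strata_index I. stratum_prob P Y \<mu> g I i * stratum_sd P Y \<phi> \<mu> g I i"
  assumes r: "linear_order_on (strata_index I) r" and M: "0 < M" and T: "0 < T"
  shows "\<bar>real M * strat_variance P Y \<phi> r I M \<mu> g (opt_alloc P Y \<phi> \<mu> g I) - T\<^sup>2\<bar>
    \<le> T\<^sup>2 * (2 * real I ^ CARD('m) / real M)"
proof -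
  let ?q = "opt_alloc P Y \<phi> \<mu> g I"
  let ?n = "num_draws r I M ?q"
  let ?J = "strata_index I :: ('m \<Rightarrow> nat) set"
  have q: "?q i = stratum_prob P Y \<mu> g I i * stratum_sd P Y \<phi> \<mu> g I i / T" for i
    by (simp add: opt_alloc_def T_def)
  have "0 \<le> ?q i" for i
    unfolding q using T
    by (auto simp: stratum_prob_def stratum_sd_def stratum_var_nonneg intro!: divide_nonneg_pos mult_nonneg_nonneg)
  moreover have "(\<Sum>i\<in>?J. ?q i) = 1"
    unfolding q using T by (simp flip: sum_divide_distrib add: T_def)
  ultimately have bound: "\<bar>(\<Sum>i\<in>{i \<in> ?J. 0 < ?n i}. real M * (?q i)\<^sup>2 / ?n i) - 1\<bar>
      \<le> 2 * card ?J / real M"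
    using M num_draws_rounding[OF r] by (intro rounded_allocation_variance) auto
  have summand: "real M * (inverse (real_of_int (?n i)) * (stratum_prob P Y \<mu> g I i)\<^sup>2 * stratum_var P Y \<phi> \<mu> g I i)
      = T\<^sup>2 * (real M * (?q i)\<^sup>2 / ?n i)" for i
  proof -
    have "(stratum_prob P Y \<mu> g I i)\<^sup>2 * stratum_var P Y \<phi> \<mu> g I i
        = (stratum_prob P Y \<mu> g I i * stratum_sd P Y \<phi> \<mu> g I i)\<^sup>2"
      by (simp add: stratum_sd_def power_mult_distrib stratum_var_nonneg)
    also have "\<dots> = (T * ?q i)\<^sup>2"
      using T by (simp add: q)
    finally have "(stratum_prob P Y \<mu> g I i)\<^sup>2 * stratum_var P Y \<phi> \<mu> g I i = T\<^sup>2 * (?q i)\<^sup>2"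
      by (simp add: power_mult_distrib)
    then show ?thesis
      by (simp add: divide_inverse mult_ac)
  qed
  define R where "R = (\<Sum>i\<in>{i \<in> ?J. 0 < ?n i}. real M * (?q i)\<^sup>2 / ?n i)"
  have "real M * strat_variance P Y \<phi> r I M \<mu> g ?q = T\<^sup>2 * R"
    unfolding strat_variance_def R_def sum_distrib_left by (intro sum.cong refl summand)
  then have "\<bar>real M * strat_variance P Y \<phi> r I M \<mu> g ?q - T\<^sup>2\<bar> = \<bar>T\<^sup>2 * (R - 1)\<bar>"
    by (simp add: right_diff_distrib)
  also have "\<dots> = T\<^sup>2 * \<bar>R - 1\<bar>"
    by (simp add: abs_mult)
  also have "\<dots> \<le> T\<^sup>2 * (2 * card ?J / real M)"
    using bound unfolding R_def by (intro mult_left_mono) simp_all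
  finally show ?thesis
    by (simp add: card_strata_index)
qed

theorem proposition2:
  fixes P :: "'a measure"
    and Y :: "'a \<Rightarrow> real ^ 'd"
    and \<phi> :: "real ^ 'd \<Rightarrow> real"
    and g :: "'m::finite \<Rightarrow> real \<Rightarrow> real"
    and \<mu> :: "real ^ 'm ^ 'd"
    and f \<psi> \<zeta> :: "real ^ 'm \<Rightarrow> real"
    and r :: "nat \<Rightarrow> (('m \<Rightarrow> nat) \<times> ('m \<Rightarrow> nat)) set"
  assumes "CARD('m) < CARD('d)"
    and "prob_space P"
    and "Y \<in> borel_measurable P"
    and "\<phi> \<in> borel_measurable borel"
    and "integrable P (\<lambda>\<omega>. (\<phi> (Y \<omega>))\<^sup>2)"
    and "\<And>k. prob_density (g k)"
    and "transpose \<mu> ** \<mu> = mat 1"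
    and "\<And>x. 0 \<le> f x"
    and "distributed P lborel (\<lambda>\<omega>. transpose \<mu> *v Y \<omega>) (\<lambda>x. ennreal (f x))"
    and "cond_exp_given P (\<lambda>\<omega>. \<phi> (Y \<omega>)) (\<lambda>\<omega>. transpose \<mu> *v Y \<omega>) \<psi>"
    and "cond_exp_given P (\<lambda>\<omega>. (\<phi> (Y \<omega>))\<^sup>2) (\<lambda>\<omega>. transpose \<mu> *v Y \<omega>) \<zeta>"
    and "(\<integral>x. f x * sqrt (\<zeta> x - (\<psi> x)\<^sup>2) \<partial>lborel) > 0"
    and "\<And>h. h \<in> {f, (\<lambda>x. \<zeta> x * f x), (\<lambda>x. \<psi> x * f x)} \<Longrightarrow>
           (\<integral>\<^sup>+ x. ennreal ((h x)\<^sup>2) / ennreal (\<Prod>k\<in>UNIV. g k (x $ k)) \<partial>lborel) < \<infinity>"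
    and "\<And>I. linear_order_on (strata_index I) (r I)"
  shows "(\<lambda>I. \<Sum>i \<in> strata_index I.
            \<bar>opt_alloc P Y \<phi> \<mu> g I i - (LINT x : stratum g I i | lborel. opt_density f \<zeta> \<psi> x)\<bar>)
          \<longlonglongrightarrow> 0
       \<and> (\<forall>IM :: nat \<Rightarrow> nat.
            (\<forall>M\<ge>1. IM M > 0) \<longrightarrow>
            (\<lambda>M. inverse (real (IM M)) + real (IM M) ^ CARD('m) * inverse (real M)) \<longlonglongrightarrow> 0 \<longrightarrow>
            (\<lambda>M. ennreal (real M *
                 strat_variance P Y \<phi> (r (IM M)) (IM M) M \<mu> g (opt_alloc P Y \<phi> \<mu> g (IM M))))
              \<longlonglongrightarrow> asymp_variance f \<zeta> \<psi> (opt_density f \<zeta> \<psi>))"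
proof -
  note P = assms(2) and W2 = assms(5) and g = assms(6) and f = assms(8) and D = assms(9)
    and \<psi> = assms(10) and \<zeta> = assms(11)
  interpret P: prob_space P by (rule P)
  let ?X = "\<lambda>\<omega>. transpose \<mu> *v Y \<omega>" and ?pd = "product_density g"
  let ?H = "\<lambda>x. f x * sqrt (\<zeta> x - (\<psi> x)\<^sup>2)"
  define C where "C = (\<integral>x. ?H x \<partial>lborel)"
  have C: "0 < C"
    using assms(12) by (simp add: C_def)
  have f_meas [measurable]: "f \<in> borel_measurable borel"
    using distributed_real_measurable[OF _ D] f by simp
  have [measurable]: "\<psi> \<in> borel_measurable borel" "\<zeta> \<in> borel_measurable borel"
    using \<psi> \<zeta> by (auto simp: cond_exp_given_def)
  note [measurable] = measurable_product_density[OF g] assms(3,4)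
  have W1: "integrable P (\<lambda>\<omega>. \<phi> (Y \<omega>))"
    using measurable_compose[OF assms(3,4)] W2 by (rule P.square_integrable_imp_integrable)

  \<comment> \<open>\<open>f\<close> and hence its products with other functions vanish where the
    reference density does, so all integrals can be moved to the product measure.\<close>
  have f0: "AE x in lborel. ?pd x = 0 \<longrightarrow> f x = 0"
  proof (rule AE_zero_of_quotient_integral_finite)
    show "(\<integral>\<^sup>+ x. ennreal ((f x)\<^sup>2) / ennreal (?pd x) \<partial>lborel) < \<infinity>"
      unfolding product_density_def by (rule assms(13)) simp
  qed (simp_all add: product_density_nonneg[of g, OF g])
  have le: "AE x in lborel. 0 < f x \<longrightarrow> (\<psi> x)\<^sup>2 \<le> \<zeta> x"
    by (rule cond_exp_given_power2_le[OF P f D W1 W2 \<psi> \<zeta>])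
  have int_f: "integrable lborel f"
  proof -
    have "(\<integral>\<^sup>+ x. ennreal (f x) \<partial>lborel) = (\<integral>\<^sup>+ \<omega>. 1 \<partial>P)"
      using distributed_nn_integral[OF D, of "\<lambda>_. 1"] by simp
    also have "\<dots> = 1"
      using P.emeasure_space_1 by simp
    finally show ?thesis
      using f by (intro integrableI_nonneg AE_I2) simp_all
  qed
  have int_\<psi>: "integrable lborel (\<lambda>x. f x * \<psi> x)"
    by (rule cond_exp_given_integrable[OF P f D W1 \<psi>])
  have int_\<zeta>: "integrable lborel (\<lambda>x. f x * \<zeta> x)"
    by (rule cond_exp_given_integrable[OF P f D W2 \<zeta>])

  let ?N = "product_measure g"
  interpret N: partition_sequence ?N strata_index "stratum g"
    using g by (rule partition_sequence_strata)
  \<comment> \<open>The pointwise discriminant of the three quotients contains the factor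
    \<open>(f x / ?pd x)^2\<close>, whose root is the quotient itself since both functions are
    nonnegative.\<close>
  have H_eq: "sqrt (f x / ?pd x * (f x * \<zeta> x / ?pd x) - (f x * \<psi> x / ?pd x)\<^sup>2) = ?H x / ?pd x" for x
  proof -
    have "f x / ?pd x * (f x * \<zeta> x / ?pd x) - (f x * \<psi> x / ?pd x)\<^sup>2
        = (f x / ?pd x)\<^sup>2 * (\<zeta> x - (\<psi> x)\<^sup>2)"
      by (simp add: power2_eq_square diff_divide_distrib[symmetric] algebra_simps)
    then show ?thesis
      using f product_density_nonneg[of g, OF g] by (simp add: real_sqrt_mult)
  qed
  have h0: "AE x in lborel. ?pd x = 0 \<longrightarrow> f x * u x = 0" for u
    using f0 by eventually_elim auto
  have int_N: "integrable ?N (\<lambda>x. f x / ?pd x)" "integrable ?N (\<lambda>x. f x * \<zeta> x / ?pd x)"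
      "integrable ?N (\<lambda>x. f x * \<psi> x / ?pd x)"
    using int_f int_\<psi> int_\<zeta> f0 h0 by (simp_all add: integrable_product_measure_quotient[of g, OF g])
  have int_HN: "integrable ?N (\<lambda>x. ?H x / ?pd x)"
    using integrable_sqrt_discriminant[OF int_N] unfolding H_eq .
  then have int_H: "integrable lborel ?H"
    by (subst (asm) integrable_product_measure_quotient[of g, OF g _ h0]) auto

  \<comment> \<open>Convergence of the optimal allocation\<close>
  define a where "a I i = stratum_prob P Y \<mu> g I i * stratum_sd P Y \<phi> \<mu> g I i" for I i
  define b where "b I i = (LINT x:stratum g I i|lborel. ?H x)" for I i
  have a: "a I i = sqrt ((LINT x:stratum g I i|lborel. f x) * (LINT x:stratum g I i|lborel. f x * \<zeta> x)
        - (LINT x:stratum g I i|lborel. f x * \<psi> x)\<^sup>2)" for I i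
    unfolding a_def by (rule stratum_prob_times_sd[OF P W1 W2 f D \<psi> \<zeta>])
  have a_nonneg: "0 \<le> a I i" for I i
    unfolding a_def by (auto simp: stratum_prob_def stratum_sd_def stratum_var_nonneg)
  note q = set_integral_product_measure_quotient[of g, OF g _ _ sets_stratum]
  have dist: "(\<lambda>I. \<Sum>i\<in>strata_index I. \<bar>a I i - b I i\<bar>) \<longlonglongrightarrow> 0"
    using N.cell_sqrt_discriminant_tendsto[OF int_N osc_strata_tendsto_0[of g, OF g int_N(1)]
        osc_strata_tendsto_0[of g, OF g int_N(2)] osc_strata_tendsto_0[of g, OF g int_N(3)]]
    unfolding H_eq using f0 by (simp add: q q[OF _ h0] a b_def)
  \<comment> \<open>The strata are known to cover up to a null set of the product measure, so the
    total is computed there; \<open>?H\<close> vanishes where that measure has density zero.\<close>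
  have total_b: "(\<Sum>i\<in>strata_index I. b I i) = C" if "0 < I" for I
  proof -
    have "C = (LINT x:UNIV|lborel. ?H x)"
      by (simp add: C_def set_lebesgue_integral_def)
    also have "\<dots> = (LINT x:UNIV|?N. ?H x / ?pd x)"
      by (rule set_integral_product_measure_quotient[of g, OF g _ h0, symmetric]) auto
    also have "\<dots> = (LINT x:(\<Union>i\<in>strata_index I. stratum g I i)|?N. ?H x / ?pd x)"
      using AE_stratum_cover[of g, OF g that] by (intro set_integral_cong_set) (auto simp: set_borel_measurable_def)
    also have "\<dots> = (\<Sum>i\<in>strata_index I. LINT x:stratum g I i|?N. ?H x / ?pd x)"
      using int_HN by (intro set_integral_finite_Union disjoint_strata) (auto intro: N.set_integrable_cell)
    also have "\<dots> = (\<Sum>i\<in>strata_index I. b I i)"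
      by (simp add: q[OF _ h0] b_def)
    finally show ?thesis by simp
  qed
  define T where "T I = (\<Sum>i\<in>strata_index I. a I i)" for I
  \<comment> \<open>The distance of the totals is at most the summed distance of the terms. This is
    used from \<open>I = 1\<close> on, since the empty index set at \<open>I = 0\<close> has total 0
    and not \<open>C\<close>.\<close>
  have T_lim: "T \<longlonglongrightarrow> C"
  proof (rule LIM_zero_cancel, rule Lim_null_comparison[OF _ dist])
    show "\<forall>\<^sub>F I in sequentially. norm (T I - C) \<le> (\<Sum>i\<in>strata_index I. \<bar>a I i - b I i\<bar>)"
    proof (rule eventually_sequentiallyI[of 1])
      fix I :: nat assume "1 \<le> I"
      then have "T I - C = (\<Sum>i\<in>strata_index I. a I i - b I i)"
        using total_b[of I] by (simp add: T_def sum_subtractf)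
      then show "norm (T I - C) \<le> (\<Sum>i\<in>strata_index I. \<bar>a I i - b I i\<bar>)"
        by (simp add: sum_abs)
    qed
  qed
  have b_opt: "(LINT x:stratum g I i|lborel. opt_density f \<zeta> \<psi> x) = b I i / C" for I i
    by (simp add: opt_density_def b_def C_def)
  have "(\<lambda>I. \<Sum>i \<in> strata_index I.
      \<bar>opt_alloc P Y \<phi> \<mu> g I i - (LINT x : stratum g I i | lborel. opt_density f \<zeta> \<psi> x)\<bar>) \<longlonglongrightarrow> 0"
    using normalized_l1_distance_tendsto_0[OF C a_nonneg dist T_lim[unfolded T_def]]
    unfolding b_opt opt_alloc_def a_def .

  \<comment> \<open>Convergence of the variance along the sequence of strata numbers\<close>
  moreover have "(\<lambda>M. ennreal (real M *
        strat_variance P Y \<phi> (r (IM M)) (IM M) M \<mu> g (opt_alloc P Y \<phi> \<mu> g (IM M))))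
      \<longlonglongrightarrow> asymp_variance f \<zeta> \<psi> (opt_density f \<zeta> \<psi>)"
    if IM: "\<forall>M\<ge>1. IM M > 0"
      and lim: "(\<lambda>M. inverse (real (IM M)) + real (IM M) ^ CARD('m) * inverse (real M)) \<longlonglongrightarrow> 0"
    for IM :: "nat \<Rightarrow> nat"
  proof -
    let ?V = "\<lambda>M. real M * strat_variance P Y \<phi> (r (IM M)) (IM M) M \<mu> g (opt_alloc P Y \<phi> \<mu> g (IM M))"
    \<comment> \<open>Both summands in \<open>lim\<close> are nonnegative, so each tends to 0 on its
      own. The first forces \<open>IM\<close> to infinity; the second makes the number of strata
      negligible against \<open>M\<close>.\<close>
    have inv: "(\<lambda>M. inverse (real (IM M))) \<longlonglongrightarrow> 0"
      by (rule tendsto_sandwich[OF _ _ tendsto_const lim]) auto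
    have ratio: "(\<lambda>M. real (IM M) ^ CARD('m) * inverse (real M)) \<longlonglongrightarrow> 0"
      by (rule tendsto_sandwich[OF _ _ tendsto_const lim]) auto
    have "filterlim (\<lambda>M. inverse (inverse (real (IM M)))) at_top sequentially"
      using inv IM by (intro filterlim_inverse_at_top eventually_sequentiallyI[of 1]) auto
    then have "filterlim IM sequentially sequentially"
      by (simp add: filterlim_sequentially_iff_filterlim_real)
    then have T_IM: "(\<lambda>M. T (IM M)) \<longlonglongrightarrow> C"
      by (rule filterlim_compose[OF T_lim])
    have T_pos: "\<forall>\<^sub>F M in sequentially. 0 < T (IM M)"
      using T_IM C by (rule order_tendstoD(1))
    have err: "(\<lambda>M. (T (IM M))\<^sup>2 * (2 * (real (IM M) ^ CARD('m) * inverse (real M)))) \<longlonglongrightarrow> C\<^sup>2 * (2 * 0)"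
      by (intro tendsto_intros T_IM ratio)
    \<comment> \<open>The rounding bound requires \<open>T (IM M)\<close> to be positive, which
      holds eventually because the limit \<open>C\<close> is positive.\<close>
    have "(\<lambda>M. ?V M - (T (IM M))\<^sup>2) \<longlonglongrightarrow> 0"
    proof (rule Lim_null_comparison)
      show "\<forall>\<^sub>F M in sequentially. norm (?V M - (T (IM M))\<^sup>2)
          \<le> (T (IM M))\<^sup>2 * (2 * (real (IM M) ^ CARD('m) * inverse (real M)))"
        using T_pos eventually_ge_at_top[of 1]
      proof eventually_elim
        case (elim M)
        then show ?case
          using strat_variance_opt_alloc_bound[of "IM M" "r (IM M)" M P Y \<mu> g \<phi>] assms(14)[of "IM M"]
          by (simp add: T_def a_def divide_inverse mult.assoc)
      qed
    qed (use err in simp)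
    then have "(\<lambda>M. (?V M - (T (IM M))\<^sup>2) + (T (IM M))\<^sup>2) \<longlonglongrightarrow> 0 + C\<^sup>2"
      by (intro tendsto_intros T_IM)
    then have "(\<lambda>M. ennreal (?V M)) \<longlonglongrightarrow> ennreal (C\<^sup>2)"
      by (intro tendsto_ennrealI) simp
    also have "ennreal (C\<^sup>2) = asymp_variance f \<zeta> \<psi> (opt_density f \<zeta> \<psi>)"
      using asymp_variance_opt_density[OF f int_H le assms(12)] by (simp add: C_def)
    finally show ?thesis .
  qed
  ultimately show ?thesis
    by blast
qed

end
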